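(* (1) $E_0$ is not infinite time computably reducible to the equality relation $=$ on $\mathbb{R}$. (2) $E_{\mathrm{set}}$ is not infinite time computably reducible to $E_0$. (3) Neither $\cong_{\mathrm{HC}}$ nor $E_{\mathrm{set}}$ is infinite time computably reducible to $\cong_{\mathrm{WO}}$.
   Context: $\mathbb{R}=2^\omega$. Infinite time Turing machines: Turing machines with three binary $\omega$-tapes run in transfinite ordinal time, with a special limit state at limit stages, head reset to the first cell, cells taking the $\limsup$ of earlier values. A function is infinite time computable if computed by such a machine, possibly with a fixed real parameter. For equivalence relations $E$ on $X\subseteq\mathbb{R}$, $F$ on $Y\subseteq\mathbb{R}$, $E\le_c F$ means there is an infinite time computable $f:X\to Y$ with $x\,E\,x'\iff f(x)\,F\,f(x')$. $x\,E_0\,y$ iff $x(n)=y(n)$ for all but finitely many $n$. A real $x$ codes a countable sequence of reals $(x)_n$ (via a fixed recursive pairing), and $x\,E_{\mathrm{set}}\,y$ iff $\{(x)_n:n\in\omega\}=\{(y)_n:n\in\omega\}$. A real codes a binary relation on $\omega$ via bit $\langle n,m\rangle$; $\mathrm{WO}$ is the set of codes of well-orders and $\cong_{\mathrm{WO}}$ is isomorphism on $\mathrm{WO}$; $\cong_{\mathrm{HC}}$ is isomorphism restricted to the set of reals coding hereditarily countable sets (codes of well-founded extensional relations on $\omega$, representing the transitive closure of a set). *)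

theory Defs
  imports Main "HOL-Library.Nat_Bijection"
begin

type_synonym cantor = "nat \<Rightarrow> bool"

record config =
  st  :: nat
  hd  :: nat
  inp :: "nat \<Rightarrow> bool"
  scr :: "nat \<Rightarrow> bool"
  out :: "nat \<Rightarrow> bool"

text \<open>A program: finitely many states 0..<nst, with 0 the start state, 1 the halt
  state, 2 the limit state.  The transition function reads the three bits under
  the head and returns (new state, bit written on tape 1, tape 2, tape 3,
  move right? ).\<close>
record prog =
  nst   :: nat
  delta :: "nat \<Rightarrow> bool \<Rightarrow> bool \<Rightarrow> bool \<Rightarrow> nat \<times> bool \<times> bool \<times> bool \<times> bool"

definition start_state :: nat where "start_state = 0"
definition halt_state :: nat where "halt_state = 1"
definition limit_state :: nat where "limit_state = 2"

definition valid_prog :: "prog \<Rightarrow> bool" where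
  "valid_prog P \<longleftrightarrow> 3 \<le> nst P \<and>
     (\<forall>q < nst P. \<forall>a b c. fst (delta P q a b c) < nst P)"

definition init_config :: "cantor \<Rightarrow> config" where
  "init_config w = \<lparr>st = start_state, hd = 0, inp = w, scr = (\<lambda>_. False), out = (\<lambda>_. False)\<rparr>"

text \<open>One computation step; moving left from cell 0 leaves the head on cell 0
  (natural-number subtraction).\<close>
definition step :: "prog \<Rightarrow> config \<Rightarrow> config" where
  "step P c = (let h = hd c;
                   (q', w1, w2, w3, mv) = delta P (st c) (inp c h) (scr c h) (out c h)
               in \<lparr>st = q', hd = (if mv then h + 1 else h - 1),
                   inp = (inp c)(h := w1), scr = (scr c)(h := w2), out = (out c)(h := w3)\<rparr>)"

definition lt_in :: "'t rel \<Rightarrow> 't \<Rightarrow> 't \<Rightarrow> bool" where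
  "lt_in r s t \<longleftrightarrow> (s, t) \<in> r \<and> s \<noteq> t"

definition is_least_in :: "'t rel \<Rightarrow> 't \<Rightarrow> bool" where
  "is_least_in r t \<longleftrightarrow> (\<forall>s\<in>Field r. (t, s) \<in> r)"

definition immediate_pred :: "'t rel \<Rightarrow> 't \<Rightarrow> 't \<Rightarrow> bool" where
  "immediate_pred r s t \<longleftrightarrow> s \<in> Field r \<and> lt_in r s t \<and>
     \<not> (\<exists>u\<in>Field r. lt_in r s u \<and> lt_in r u t)"

definition is_limit_in :: "'t rel \<Rightarrow> 't \<Rightarrow> bool" where
  "is_limit_in r t \<longleftrightarrow> \<not> is_least_in r t \<and> \<not> (\<exists>s. immediate_pred r s t)"

definition limsup_before :: "'t rel \<Rightarrow> 't \<Rightarrow> ('t \<Rightarrow> bool) \<Rightarrow> bool" where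
  "limsup_before r t f \<longleftrightarrow>
     (\<forall>s\<in>Field r. lt_in r s t \<longrightarrow> (\<exists>u\<in>Field r. (s, u) \<in> r \<and> lt_in r u t \<and> f u))"

definition limit_config :: "'t rel \<Rightarrow> 't \<Rightarrow> ('t \<Rightarrow> config) \<Rightarrow> config" where
  "limit_config r t c = \<lparr>st = limit_state, hd = 0,
      inp = (\<lambda>i. limsup_before r t (\<lambda>u. inp (c u) i)),
      scr = (\<lambda>i. limsup_before r t (\<lambda>u. scr (c u) i)),
      out = (\<lambda>i. limsup_before r t (\<lambda>u. out (c u) i))\<rparr>"

definition ittm_run :: "'t rel \<Rightarrow> ('t \<Rightarrow> config) \<Rightarrow> prog \<Rightarrow> cantor \<Rightarrow> bool" where
  "ittm_run r c P w \<longleftrightarrow> Well_order r \<and>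
     (\<forall>t\<in>Field r.
        (is_least_in r t \<longrightarrow> c t = init_config w) \<and>
        (\<forall>s. immediate_pred r s t \<longrightarrow> c t = step P (c s)) \<and>
        (is_limit_in r t \<longrightarrow> c t = limit_config r t c)) \<and>
     (\<forall>s\<in>Field r. st (c s) = halt_state \<longrightarrow> (\<forall>t\<in>Field r. (t, s) \<in> r))"

text \<open>P on input w halts with output y.  Times are indexed by well-orders on
  the type nat set, which has the size of the continuum and hence accommodates
  every countable ordinal (all ITTM halting times are countable).\<close>
definition halts_with :: "prog \<Rightarrow> cantor \<Rightarrow> cantor \<Rightarrow> bool" where
  "halts_with P w y \<longleftrightarrow>
     (\<exists>(r :: nat set rel) c m. ittm_run r c P w \<and> m \<in> Field r \<and>
        (\<forall>s\<in>Field r. (s, m) \<in> r) \<and> st (c m) = halt_state \<and> out (c m) = y)"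

definition join :: "cantor \<Rightarrow> cantor \<Rightarrow> cantor" where
  "join x z n = (if even n then x (n div 2) else z (n div 2))"

definition itt_computable_on :: "cantor set \<Rightarrow> (cantor \<Rightarrow> cantor) \<Rightarrow> bool" where
  "itt_computable_on X f \<longleftrightarrow>
     (\<exists>P z. valid_prog P \<and> (\<forall>x\<in>X. halts_with P (join x z) (f x)))"

definition itt_reducible ::
  "(cantor \<Rightarrow> cantor \<Rightarrow> bool) \<Rightarrow> cantor set \<Rightarrow> (cantor \<Rightarrow> cantor \<Rightarrow> bool) \<Rightarrow> cantor set \<Rightarrow> bool" where
  "itt_reducible E X F Y \<longleftrightarrow>
     (\<exists>f. (\<forall>x\<in>X. f x \<in> Y) \<and> itt_computable_on X f \<and>
          (\<forall>x\<in>X. \<forall>x'\<in>X. E x x' \<longleftrightarrow> F (f x) (f x')))"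

definition E0 :: "cantor \<Rightarrow> cantor \<Rightarrow> bool" where
  "E0 x y \<longleftrightarrow> finite {n. x n \<noteq> y n}"

definition seq_entry :: "cantor \<Rightarrow> nat \<Rightarrow> cantor" where
  "seq_entry x n = (\<lambda>m. x (prod_encode (n, m)))"

definition Eset :: "cantor \<Rightarrow> cantor \<Rightarrow> bool" where
  "Eset x y \<longleftrightarrow> range (seq_entry x) = range (seq_entry y)"

definition coded_rel :: "cantor \<Rightarrow> nat rel" where
  "coded_rel x = {(n, m). x (prod_encode (n, m))}"

definition WO :: "cantor set" where
  "WO = {x. Well_order (coded_rel x)}"

definition iso_WO :: "cantor \<Rightarrow> cantor \<Rightarrow> bool" where
  "iso_WO x y \<longleftrightarrow> (coded_rel x, coded_rel y) \<in> ordIso"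

definition HC :: "cantor set" where
  "HC = {x. wf (coded_rel x) \<and>
            (\<forall>n m. (\<forall>k. (k, n) \<in> coded_rel x \<longleftrightarrow> (k, m) \<in> coded_rel x) \<longrightarrow> n = m)}"

definition iso_HC :: "cantor \<Rightarrow> cantor \<Rightarrow> bool" where
  "iso_HC x y \<longleftrightarrow> (\<exists>f. bij f \<and>
      (\<forall>n m. (n, m) \<in> coded_rel x \<longleftrightarrow> (f n, f m) \<in> coded_rel y))"

end

theory Submission
  imports Defs "HOL-Analysis.Analysis"
begin

text \<open>
  Everything rests on Baire category.  Let the input of an infinite time Turing machine depend on a
  parameter \<open>w\<close> of a second countable space, each input bit having the Baire property as a set of
  parameters.  Then so has every cell at every countable stage.  As the basis is countable, the pairs
  (basic open set, cell) for which the set forces the cell to be 1 at arbitrarily late countable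
  stages stabilise; hence at two suitable countable limit stages the configurations agree for
  comeagerly many \<open>w\<close>, no cell that is 0 there is 1 in between, and the machine has halted by then or
  loops forever.  So the output bits of a machine that always halts have the Baire property too.

  (1) By the topological 0-1 law, an \<open>E0\<close>-invariant function whose bits have the Baire property is
  constant on a comeager set, but \<open>E0\<close>-classes are meager.

  (2) Take the set of all \<open>(i, y)\<close> with \<open>y E0 a i\<close>, enumerated along a generic \<open>h\<close>.  For fixed \<open>a\<close> the values of
  the reduction lie in one countable \<open>E0\<close>-class, so they are constant for generic \<open>h\<close> in some cylinder.
  The cylinder mentions only finitely many indices; for an unmentioned \<open>k\<close> that constant is an
  \<open>E0\<close>-invariant function of \<open>a k\<close>, hence generically constant, although the set determines \<open>a k\<close> up to
  \<open>E0\<close>.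

  (3) Already equality does not reduce to isomorphism of well-orders: for generic \<open>w\<close> the ranks in the
  well-order assigned to \<open>w\<close> are bounded by one countable ordinal, so countably many meager classes
  would cover a comeager set.
\<close>

section \<open>Meager sets and the Baire property\<close>

definition meager :: "'a::topological_space set \<Rightarrow> bool" where
  "meager A \<longleftrightarrow> (\<exists>F. countable F \<and> (\<forall>C\<in>F. closed C \<and> interior C = {}) \<and> A \<subseteq> \<Union>F)"

lemma meager_subset: "meager B \<Longrightarrow> A \<subseteq> B \<Longrightarrow> meager A"
  unfolding meager_def by (meson order_trans)

lemma meager_empty [simp]: "meager {}"
  unfolding meager_def by (intro exI[of _ "{}"]) auto

lemma meager_closed: "closed C \<Longrightarrow> interior C = {} \<Longrightarrow> meager C"
  unfolding meager_def by (intro exI[of _ "{C}"]) auto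

lemma meager_UN:
  assumes "countable I" "\<And>i. i \<in> I \<Longrightarrow> meager (A i)"
  shows "meager (\<Union>i\<in>I. A i)"
proof -
  have "\<forall>i\<in>I. \<exists>F. countable F \<and> (\<forall>C\<in>F. closed C \<and> interior C = {}) \<and> A i \<subseteq> \<Union>F"
    using assms(2) unfolding meager_def by blast
  then obtain F where F: "\<forall>i\<in>I. countable (F i) \<and> (\<forall>C\<in>F i. closed C \<and> interior C = {}) \<and> A i \<subseteq> \<Union>(F i)"
    by metis
  show ?thesis
    unfolding meager_def
  proof (intro exI[of _ "\<Union>i\<in>I. F i"] conjI)
    show "countable (\<Union>i\<in>I. F i)" using F assms(1) by auto
    show "\<forall>C\<in>\<Union>i\<in>I. F i. closed C \<and> interior C = {}" using F by (simp add: ball_UN)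
    have "A i \<subseteq> \<Union>(\<Union>i\<in>I. F i)" if "i \<in> I" for i
      using F that by (meson UN_upper Union_mono order_trans)
    then show "(\<Union>i\<in>I. A i) \<subseteq> \<Union>(\<Union>i\<in>I. F i)" by (simp add: UN_subset_iff)
  qed
qed

lemma meager_Un: "meager A \<Longrightarrow> meager B \<Longrightarrow> meager (A \<union> B)"
  using meager_UN[of "{A, B}" "\<lambda>x. x"] by auto

text \<open>The set is the boundary of \<open>U\<close>: an open part of it would lie in the
  interior of \<open>- U\<close>, which has been removed.\<close>

lemma meager_frontier_open:
  assumes "open U" shows "meager (- U - interior (- U))"
proof (rule meager_closed)
  show "closed (- U - interior (- U))" using assms by (intro closed_Diff) auto
  have "interior (- U - interior (- U)) \<subseteq> interior (- U)" by (intro interior_mono) auto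
  moreover have "interior (- U - interior (- U)) \<subseteq> - interior (- U)"
    using interior_subset by blast
  ultimately show "interior (- U - interior (- U)) = {}" by blast
qed

text \<open>Continuity keeps preimages of closed sets closed. Openness of \<open>f\<close> sends an
  open subset of such a preimage into the interior of the closed set, which is empty.\<close>

lemma meager_vimage:
  fixes f :: "'a::topological_space \<Rightarrow> 'b::topological_space"
  assumes "meager A" and cont: "continuous_on UNIV f"
    and op: "\<And>W. open W \<Longrightarrow> open (f ` W)"
  shows "meager (f -` A)"
proof -
  obtain F where F: "countable F" "\<forall>C\<in>F. closed C \<and> interior C = {}" "A \<subseteq> \<Union>F"
    using assms(1) unfolding meager_def by blast
  have "interior (f -` C) = {}" if "C \<in> F" for C
  proof -
    have "f ` interior (f -` C) \<subseteq> C" using interior_subset by blast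
    then have "f ` interior (f -` C) \<subseteq> interior C"
      by (intro interior_maximal op) auto
    then show ?thesis using F(2) that by auto
  qed
  moreover have "closed (f -` C)" if "C \<in> F" for C
    using F(2) that cont by (simp add: closed_vimage)
  ultimately have "meager (\<Union>C\<in>F. f -` C)" by (intro meager_UN meager_closed F(1)) auto
  then show ?thesis by (rule meager_subset) (use F(3) in blast)
qed

lemma meager_vimage_involution:
  assumes "meager A" "continuous_on UNIV f" "\<And>x. f (f x) = x"
  shows "meager (f -` A)"
proof (rule meager_vimage[OF assms(1,2)])
  fix W :: "'a set" assume "open W"
  moreover have "f ` W = f -` W" using assms(3) by (auto simp: image_iff) metis
  ultimately show "open (f ` W)" using assms(2) by (simp add: open_vimage)
qed

section \<open>Sets with the Baire property\<close>

definition baire_property :: "'a::topological_space set \<Rightarrow> bool" where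
  "baire_property A \<longleftrightarrow> (\<exists>U. open U \<and> meager (A - U) \<and> meager (U - A))"

lemma baire_property_open: "open U \<Longrightarrow> baire_property U"
  unfolding baire_property_def by (intro exI[of _ U]) auto

lemma baire_property_trivial [simp]: "baire_property {}" "baire_property UNIV"
  by (simp_all add: baire_property_open)

text \<open>If \<open>U\<close> approximates \<open>A\<close>, the interior of \<open>- U\<close>
  approximates \<open>- A\<close>; the only new error is the boundary of \<open>U\<close>.\<close>

lemma baire_property_Compl:
  assumes "baire_property A" shows "baire_property (- A)"
proof -
  obtain U where U: "open U" "meager (A - U)" "meager (U - A)"
    using assms unfolding baire_property_def by blast
  let ?V = "interior (- U)"
  have "meager (- A - ?V)"
    by (rule meager_subset[OF meager_Un[OF U(3) meager_frontier_open[OF U(1)]]]) auto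
  moreover have "meager (?V - - A)"
    by (rule meager_subset[OF U(2)]) (use interior_subset[of "- U"] in auto)
  ultimately show ?thesis unfolding baire_property_def by blast
qed

lemma baire_property_UN:
  assumes "countable I" "\<And>i. i \<in> I \<Longrightarrow> baire_property (A i)"
  shows "baire_property (\<Union>i\<in>I. A i)"
proof -
  have "\<forall>i\<in>I. \<exists>U. open U \<and> meager (A i - U) \<and> meager (U - A i)"
    using assms(2) unfolding baire_property_def by blast
  then obtain U where U: "\<forall>i\<in>I. open (U i) \<and> meager (A i - U i) \<and> meager (U i - A i)"
    by metis
  have "meager (\<Union>i\<in>I. (A i - U i) \<union> (U i - A i))"
    using assms(1) U by (intro meager_UN meager_Un) auto
  then show ?thesis
    unfolding baire_property_def using U
    by (intro exI[of _ "\<Union>i\<in>I. U i"]) (auto elim!: meager_subset)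
qed

lemma baire_property_INT:
  assumes "countable I" "\<And>i. i \<in> I \<Longrightarrow> baire_property (A i)"
  shows "baire_property (\<Inter>i\<in>I. A i)"
proof -
  have "baire_property (- (\<Union>i\<in>I. - A i))"
    using assms by (intro baire_property_Compl baire_property_UN) auto
  then show ?thesis by simp
qed

lemma baire_property_Un: "baire_property A \<Longrightarrow> baire_property B \<Longrightarrow> baire_property (A \<union> B)"
  using baire_property_UN[of "{A, B}" "\<lambda>x. x"] by auto

lemma baire_property_Int: "baire_property A \<Longrightarrow> baire_property B \<Longrightarrow> baire_property (A \<inter> B)"
  using baire_property_INT[of "{A, B}" "\<lambda>x. x"] by auto

section \<open>The Baire property for sets defined by logical formulas\<close>

lemma baire_property_Ball:
  "countable I \<Longrightarrow> (\<And>i. i \<in> I \<Longrightarrow> baire_property {x. Q i x}) \<Longrightarrow> baire_property {x. \<forall>i\<in>I. Q i x}"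
  using baire_property_INT[of I "\<lambda>i. {x. Q i x}"] by (simp add: Collect_ball_eq)

lemma baire_property_Bex:
  "countable I \<Longrightarrow> (\<And>i. i \<in> I \<Longrightarrow> baire_property {x. Q i x}) \<Longrightarrow> baire_property {x. \<exists>i\<in>I. Q i x}"
  using baire_property_UN[of I "\<lambda>i. {x. Q i x}"] by (simp add: Collect_bex_eq)

lemma baire_property_conj:
  "baire_property {x. Q x} \<Longrightarrow> baire_property {x. R x} \<Longrightarrow> baire_property {x. Q x \<and> R x}"
  using baire_property_Int[of "{x. Q x}" "{x. R x}"] by (simp add: Collect_conj_eq)

lemma baire_property_disj:
  "baire_property {x. Q x} \<Longrightarrow> baire_property {x. R x} \<Longrightarrow> baire_property {x. Q x \<or> R x}"
  using baire_property_Un[of "{x. Q x}" "{x. R x}"] by (simp add: Collect_disj_eq)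

lemma baire_property_not: "baire_property {x. Q x} \<Longrightarrow> baire_property {x. \<not> Q x}"
  using baire_property_Compl[of "{x. Q x}"] by (simp add: Collect_neg_eq)

lemma baire_property_const: "baire_property {x. Q}"
  by (cases Q) (auto intro: baire_property_open)

lemma baire_property_iff:
  assumes "baire_property {x. Q x}" "baire_property {x. R x}"
  shows "baire_property {x. Q x \<longleftrightarrow> R x}"
proof -
  have "{x. Q x \<longleftrightarrow> R x} = {x. (Q x \<and> R x) \<or> (\<not> Q x \<and> \<not> R x)}" by auto
  then show ?thesis
    using assms by (simp add: baire_property_conj baire_property_disj baire_property_not)
qed

lemma baire_property_cong_meager:
  assumes "baire_property B" "meager (A - B)" "meager (B - A)"
  shows "baire_property A"
proof -
  obtain U where U: "open U" "meager (B - U)" "meager (U - B)"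
    using assms unfolding baire_property_def by blast
  have "meager (A - U)" "meager (U - A)"
    using meager_subset[OF meager_Un[OF assms(2) U(2)], of "A - U"]
      meager_subset[OF meager_Un[OF assms(3) U(3)], of "U - A"] by auto
  then show ?thesis using U unfolding baire_property_def by blast
qed

section \<open>Countable bases and category forcing\<close>

definition basic :: "'a::second_countable_topology set set" where
  "basic = (SOME B. countable B \<and> topological_basis B)"

lemma countable_basic: "countable basic" and topological_basis_basic: "topological_basis basic"
  using someI_ex[OF ex_countable_basis] unfolding basic_def by auto

lemma open_basic: "b \<in> basic \<Longrightarrow> open b"
  using topological_basis_basic by (auto simp: topological_basis_def)

lemma basic_subset_open:
  assumes "open U" "x \<in> U" shows "\<exists>b\<in>basic. x \<in> b \<and> b \<subseteq> U"
  using topological_basisE[OF topological_basis_basic assms] by metis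

text \<open>This is the forcing relation of category: \<open>b\<close> forces \<open>A\<close> when
  \<open>A\<close> is comeager in \<open>b\<close>. Modulo meager sets it reduces a set with the
  Baire property to countable data.\<close>

definition forced :: "'a::second_countable_topology set \<Rightarrow> 'a set set" where
  "forced A = {b\<in>basic. meager (b - A)}"

lemma countable_forced: "countable (forced A)"
  unfolding forced_def by (rule countable_subset[OF _ countable_basic]) auto

text \<open>Every basic subset of an open set approximating \<open>A\<close> forces
  \<open>A\<close>, so the forcing sets cover \<open>A\<close> up to a meager error.\<close>

lemma meager_diff_forced:
  assumes "baire_property A" shows "meager (A - \<Union>(forced A))"
proof -
  obtain U where U: "open U" "meager (A - U)" "meager (U - A)"
    using assms unfolding baire_property_def by blast
  have "U \<subseteq> \<Union>(forced A)"
  proof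
    fix x assume "x \<in> U"
    then obtain b where "b \<in> basic" "x \<in> b" "b \<subseteq> U" using basic_subset_open[OF U(1)] by blast
    then show "x \<in> \<Union>(forced A)" unfolding forced_def
      using meager_subset[OF U(3), of "b - A"] by blast
  qed
  then show ?thesis by (intro meager_subset[OF U(2)]) auto
qed

text \<open>The forcing sets cover \<open>A\<close> modulo a meager set, so they cannot all be
  empty. The clause \<open>b \<noteq> {}\<close> matters because the empty set forces
  everything.\<close>

lemma nonmeager_forced:
  assumes "baire_property A" "\<not> meager A"
  shows "\<exists>b\<in>basic. b \<noteq> {} \<and> meager (b - A)"
proof (rule ccontr)
  assume "\<not> ?thesis"
  then have "\<Union>(forced A) = {}" unfolding forced_def by auto
  then show False using meager_diff_forced[OF assms(1)] assms(2) by (metis Diff_empty)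
qed

section \<open>The Baire category theorem for the parameter spaces\<close>

lemma completely_metrizable_not_meager:
  fixes U :: "'a::topological_space set"
  assumes "completely_metrizable_space (euclidean :: 'a topology)" "open U" "U \<noteq> {}"
  shows "\<not> meager U"
proof
  assume "meager U"
  then obtain F where F: "countable F" "\<forall>C\<in>F. closed C \<and> interior C = {}" "U \<subseteq> \<Union>F"
    unfolding meager_def by blast
  have "interior (\<Union>F) = {}"
    using Baire_category_alt[of "euclidean :: 'a topology" F] assms(1) F by auto
  then show False using assms F(3) interior_maximal by blast
qed

lemma completely_metrizable_nat: "completely_metrizable_space (euclidean :: nat topology)"
proof -
  have "euclidean = discrete_topology (UNIV :: nat set)"
    using discrete_topology_unique[of "UNIV :: nat set" euclidean] by (simp add: open_discrete)
  then show ?thesis by (simp add: completely_metrizable_space_discrete_topology)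
qed

lemma completely_metrizable_fun:
  assumes "completely_metrizable_space (euclidean :: 'a::topological_space topology)"
  shows "completely_metrizable_space (euclidean :: (nat \<Rightarrow> 'a) topology)"
  by (subst euclidean_product_topology[symmetric])
    (simp add: completely_metrizable_space_product_topology assms)

lemmas not_meager_seq = completely_metrizable_not_meager[OF completely_metrizable_fun[OF completely_metrizable_nat]]
lemmas not_meager_seq2 = completely_metrizable_not_meager
  [OF completely_metrizable_fun[OF completely_metrizable_fun[OF completely_metrizable_nat]]]

text \<open>It suffices to treat one closed \<open>C\<close> with empty interior. If a section of
  \<open>C\<close> has interior, it contains a nonempty basic \<open>b\<close>; for fixed
  \<open>b\<close> the points \<open>x\<close> with this property form a closed set, and an open set
  of them times \<open>b\<close> would lie in \<open>C\<close>. There are only countably many pairs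
  of \<open>C\<close> and \<open>b\<close>.\<close>

theorem kuratowski_ulam:
  fixes A :: "('a::topological_space \<times> 'b::second_countable_topology) set"
  assumes "meager A"
  shows "meager {x. \<not> meager {y. (x, y) \<in> A}}"
proof -
  obtain F where F: "countable F" "\<forall>C\<in>F. closed C \<and> interior C = {}" "A \<subseteq> \<Union>F"
    using assms unfolding meager_def by blast
  let ?I = "F \<times> {b\<in>basic. b \<noteq> {}}"
  let ?N = "\<lambda>(C, b). {x. \<forall>y\<in>b. (x, y) \<in> C}"
  have "meager (?N (C, b))" if C: "C \<in> F" and b: "b \<in> basic" "b \<noteq> {}" for C b
  proof (rule meager_closed)
    \<comment> \<open>The complement is a projection of an open set, hence open.\<close>
    have "- ?N (C, b) = fst ` (- C \<inter> (UNIV \<times> b))" by force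
    moreover have "open (fst ` (- C \<inter> (UNIV \<times> b)))"
      using F(2) C open_basic[OF b(1)] by (intro open_image_fst open_Int open_Times) auto
    ultimately show "closed (?N (C, b))" by (simp add: closed_def)
    have "interior (?N (C, b)) \<times> b \<subseteq> interior C"
      using open_basic[OF b(1)] interior_subset by (intro interior_maximal open_Times) fastforce+
    then show "interior (?N (C, b)) = {}" using F(2) C b by auto
  qed
  then have "meager (\<Union>i\<in>?I. ?N i)"
    using F(1) countable_basic by (intro meager_UN) (auto intro: countable_subset[of _ basic])
  moreover have "meager {y. (x, y) \<in> A}" if x: "x \<notin> (\<Union>i\<in>?I. ?N i)" for x
  proof -
    have "meager {y. (x, y) \<in> C}" if C: "C \<in> F" for C
    proof (rule meager_closed)
      have "closed ((\<lambda>y. (x, y)) -` C)"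
        using F(2) C by (intro closed_vimage continuous_intros) auto
      then show "closed {y. (x, y) \<in> C}" by (simp add: vimage_def)
      show "interior {y. (x, y) \<in> C} = {}"
      proof (rule ccontr)
        assume "interior {y. (x, y) \<in> C} \<noteq> {}"
        then obtain z where z: "z \<in> interior {y. (x, y) \<in> C}" by blast
        obtain b where b: "b \<in> basic" "z \<in> b" "b \<subseteq> interior {y. (x, y) \<in> C}"
          using basic_subset_open[OF open_interior z] by blast
        then have "x \<in> ?N (C, b)" using interior_subset[of "{y. (x, y) \<in> C}"] by auto
        moreover have "(C, b) \<in> ?I" using C b by blast
        ultimately show False using x by blast
      qed
    qed
    then have "meager (\<Union>C\<in>F. {y. (x, y) \<in> C})" by (intro meager_UN F(1))
    then show ?thesis by (rule meager_subset) (use F(3) in auto)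
  qed
  ultimately show ?thesis by (elim meager_subset) blast
qed

text \<open>Replacing \<open>B\<close> by an approximating open \<open>U\<close> changes the
  condition only for meagerly many \<open>x\<close>, by \<open>kuratowski_ulam\<close>. For open
  \<open>U\<close> a section is comeager in \<open>V\<close> iff it meets every nonempty basic
  subset of \<open>V\<close>, which is a countable intersection of open projections. Completeness is
  what makes a comeager section meet a basic set.\<close>

lemma baire_property_category_quantifier:
  fixes B :: "('a::topological_space \<times> 'b::second_countable_topology) set"
  assumes complete: "completely_metrizable_space (euclidean :: 'b topology)"
    and B: "baire_property B" and V: "open V"
  shows "baire_property {x. meager {y\<in>V. (x, y) \<notin> B}}"
proof -
  obtain U where U: "open U" "meager (B - U)" "meager (U - B)"
    using B unfolding baire_property_def by blast
  let ?I = "{b\<in>basic. b \<noteq> {} \<and> b \<subseteq> V}"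
  let ?G = "\<Inter>b\<in>?I. fst ` (U \<inter> (UNIV \<times> b))"
  let ?M = "{x. \<not> meager {y. (x, y) \<in> B - U}} \<union> {x. \<not> meager {y. (x, y) \<in> U - B}}"
  have M: "meager ?M" by (intro meager_Un kuratowski_ulam U)
  have G: "x \<in> ?G \<longleftrightarrow> meager {y\<in>V. (x, y) \<notin> U}" for x
  proof
    assume x: "x \<in> ?G"
    have "open ((\<lambda>y. (x, y)) -` U)" by (intro open_vimage U(1) continuous_intros)
    then have op: "open {y. (x, y) \<in> U}" by (simp add: vimage_def)
    have "V \<inter> interior (- {y. (x, y) \<in> U}) = {}"
    proof (rule ccontr)
      assume "\<not> ?thesis"
      then obtain z where z: "z \<in> V \<inter> interior (- {y. (x, y) \<in> U})" by blast
      obtain b where b: "b \<in> basic" "z \<in> b" "b \<subseteq> V \<inter> interior (- {y. (x, y) \<in> U})"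
        using basic_subset_open[OF open_Int[OF V open_interior] z] by blast
      then have "x \<in> fst ` (U \<inter> (UNIV \<times> b))" using x by blast
      then obtain y where "(x, y) \<in> U" "y \<in> b" by auto
      then show False using b(3) interior_subset[of "- {y. (x, y) \<in> U}"] by blast
    qed
    then show "meager {y\<in>V. (x, y) \<notin> U}"
      by (intro meager_subset[OF meager_frontier_open[OF op]]) auto
  next
    assume m: "meager {y\<in>V. (x, y) \<notin> U}"
    show "x \<in> ?G"
    proof (rule INT_I)
      fix b assume b: "b \<in> ?I"
      have "\<not> b \<subseteq> {y\<in>V. (x, y) \<notin> U}"
        using completely_metrizable_not_meager[OF complete open_basic, of b] b
          meager_subset[OF m] by blast
      then show "x \<in> fst ` (U \<inter> (UNIV \<times> b))" using b by force
    qed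
  qed
  have eq: "meager {y\<in>V. (x, y) \<notin> B} \<longleftrightarrow> x \<in> ?G" if "x \<notin> ?M" for x
  proof -
    have m: "meager {y. (x, y) \<in> B - U}" "meager {y. (x, y) \<in> U - B}" using that by auto
    have "meager {y\<in>V. (x, y) \<notin> B}" if "meager {y\<in>V. (x, y) \<notin> U}"
      by (rule meager_subset[OF meager_Un[OF that m(2)]]) auto
    moreover have "meager {y\<in>V. (x, y) \<notin> U}" if "meager {y\<in>V. (x, y) \<notin> B}"
      by (rule meager_subset[OF meager_Un[OF that m(1)]]) auto
    ultimately show ?thesis using G by blast
  qed
  have "baire_property ?G"
    using countable_basic U(1) open_basic
    by (intro baire_property_INT baire_property_open open_image_fst open_Int open_Times)
      (auto intro: countable_subset[of _ basic])
  then show ?thesis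
    by (rule baire_property_cong_meager) (auto intro!: meager_subset[OF M] simp: eq simp del: INT_iff)
qed

lemma baire_property_discrete:
  fixes \<phi> :: "'a::topological_space \<Rightarrow> 'b::discrete_topology"
  assumes "continuous_on UNIV \<phi>" shows "baire_property {x. Q (\<phi> x)}"
  using open_vimage[OF open_discrete[of "{c. Q c}"] assms]
  by (intro baire_property_open) (simp add: vimage_def)

section \<open>Cylinders and the topological zero-one law\<close>

definition cylinder :: "nat \<Rightarrow> (nat \<Rightarrow> nat) \<Rightarrow> (nat \<Rightarrow> nat) set" where
  "cylinder n h = {g. \<forall>i<n. g i = h i}"

lemma open_cylinder: "open (cylinder n h)"
  using product_topology_basis'[of "{..<n}" "\<lambda>i. {h i}" "\<lambda>i. i"]
  by (simp add: cylinder_def open_discrete Ball_def)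

lemma cylinder_subset_open:
  assumes "open W" "h \<in> W" shows "\<exists>n. cylinder n h \<subseteq> W"
proof -
  obtain X where X: "h \<in> Pi\<^sub>E UNIV X" "finite {i. X i \<noteq> UNIV}" "Pi\<^sub>E UNIV X \<subseteq> W"
    using product_topology_open_contains_basis[of "\<lambda>i. euclidean" UNIV W h] assms
    by (auto simp: open_fun_def)
  obtain n where n: "\<And>i. X i \<noteq> UNIV \<Longrightarrow> i < n"
    using X(2) finite_nat_set_iff_bounded by auto
  have "g \<in> Pi\<^sub>E UNIV X" if "g \<in> cylinder n h" for g
  proof -
    have "g i \<in> X i" for i
      using X(1) n[of i] that by (cases "X i = UNIV") (auto simp: cylinder_def PiE_iff)
    then show ?thesis by auto
  qed
  then show ?thesis using X(3) by blast
qed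

text \<open>Being nonmeager, \<open>A\<close> is comeager in some cylinder. Overwriting the first
  \<open>n\<close> coordinates moves every point into that cylinder without changing its membership
  in \<open>A\<close>, and the preimage of a meager set under this map is meager.\<close>

lemma zero_one_law:
  fixes A :: "(nat \<Rightarrow> nat) set"
  assumes bp: "baire_property A"
    and inv: "\<And>g h. finite {i. g i \<noteq> h i} \<Longrightarrow> g \<in> A \<Longrightarrow> h \<in> A"
    and nm: "\<not> meager A"
  shows "meager (- A)"
proof -
  obtain b where b: "b \<in> basic" "b \<noteq> {}" "meager (b - A)"
    using nonmeager_forced[OF bp nm] by blast
  then obtain q n where q: "cylinder n q \<subseteq> b"
    using cylinder_subset_open[OF open_basic] by blast
  let ?f = "\<lambda>(z::nat \<Rightarrow> nat) h i. if i < n then z i else h i"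
  have cont: "continuous_on UNIV (?f z)" for z
  proof (rule continuous_on_coordinatewise_then_product)
    show "continuous_on UNIV (\<lambda>x. ?f z x i)" for i by (cases "i < n") simp_all
  qed
  have "meager (?f q -` (cylinder n q - A))"
  proof (rule meager_vimage[OF meager_subset[OF b(3)] cont])
    show "cylinder n q - A \<subseteq> b - A" using q by auto
    fix W :: "(nat \<Rightarrow> nat) set" assume W: "open W"
    \<comment> \<open>A point of the image has lost its first \<open>n\<close> coordinates;
      \<open>z\<close> ranges over the possible lost values, and restoring them is
      continuous.\<close>
    have "?f q ` W = (\<Union>z. cylinder n q \<inter> ?f z -` W)"
    proof safe
      fix w assume "w \<in> W"
      moreover have "?f w (?f q w) = w" by auto
      ultimately show "?f q w \<in> (\<Union>z. cylinder n q \<inter> ?f z -` W)"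
        by (auto simp: cylinder_def intro!: exI[of _ w])
    next
      fix x z assume "x \<in> cylinder n q" "?f z x \<in> W"
      moreover have "x = ?f q (?f z x)" using \<open>x \<in> cylinder n q\<close> by (auto simp: cylinder_def)
      ultimately show "x \<in> ?f q ` W" by (intro image_eqI[where x = "?f z x"])
    qed
    then show "open (?f q ` W)"
      using W cont by (simp only:) (intro open_UN ballI open_Int open_cylinder open_vimage)
  qed
  moreover have "- A \<subseteq> ?f q -` (cylinder n q - A)"
  proof
    fix h assume "h \<in> - A"
    moreover have "finite {i. ?f q h i \<noteq> h i}"
      by (rule finite_subset[of _ "{..<n}"]) auto
    ultimately have "?f q h \<notin> A" using inv[of "?f q h" h] by auto
    then show "h \<in> ?f q -` (cylinder n q - A)" by (auto simp: cylinder_def)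
  qed
  ultimately show ?thesis by (rule meager_subset)
qed

text \<open>Reals are read off from points of the Baire space, whose factors \<^typ>\<open>nat\<close> carry the discrete
  topology of the library.\<close>

definition parity :: "(nat \<Rightarrow> nat) \<Rightarrow> nat \<Rightarrow> bool" where
  "parity w n = odd (w n)"

lemma baire_property_parity: "baire_property {w. parity w n}"
  unfolding parity_def by (rule baire_property_discrete) simp

text \<open>The set is a countable union, over the place \<open>n\<close> from which agreement
  holds, of closed sets that every open set leaves by changing one late coordinate.\<close>

lemma meager_E0_class_parity: "meager {w. E0 (parity w) x}"
proof -
  let ?C = "\<lambda>n. {w. \<forall>i\<ge>n. parity w i = x i}"
  have "meager (?C n)" for n
  proof (rule meager_closed)
    have "closed ((\<lambda>w::nat\<Rightarrow>nat. w i) -` {k. odd k = x i})" for i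
      by (intro closed_vimage) (simp_all add: closed_def open_discrete)
    then have "closed (\<Inter>i\<in>{n..}. (\<lambda>w::nat\<Rightarrow>nat. w i) -` {k. odd k = x i})" by blast
    moreover have "(\<Inter>i\<in>{n..}. (\<lambda>w::nat\<Rightarrow>nat. w i) -` {k. odd k = x i}) = ?C n"
      by (auto simp: parity_def)
    ultimately show "closed (?C n)" by simp
    show "interior (?C n) = {}"
    proof (rule ccontr)
      assume "interior (?C n) \<noteq> {}"
      then obtain h where h: "h \<in> interior (?C n)" by blast
      obtain m where hm: "cylinder m h \<subseteq> ?C n"
        using cylinder_subset_open[OF open_interior h] interior_subset[of "?C n"] by blast
      let ?k = "max m n"
      \<comment> \<open>The new value has the wrong parity. As \<open>?k \<ge> m\<close> the
        cylinder is not left, and as \<open>?k \<ge> n\<close> the coordinate is one where agreement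
        is required.\<close>
      let ?w = "h(?k := (if x ?k then 0 else 1))"
      have "?w \<in> cylinder m h" by (auto simp: cylinder_def)
      then have "parity ?w ?k = x ?k" using hm by auto
      then show False by (auto simp: parity_def split: if_splits)
    qed
  qed
  then have "meager (\<Union>n. ?C n)" by (intro meager_UN) auto
  moreover have "{w. E0 (parity w) x} \<subseteq> (\<Union>n. ?C n)"
  proof safe
    fix w assume "E0 (parity w) x"
    then obtain n where "\<forall>i\<in>{i. parity w i \<noteq> x i}. i < n"
      unfolding E0_def finite_nat_set_iff_bounded by blast
    then have "w \<in> ?C n" by (auto simp: not_less[symmetric])
    then show "w \<in> (\<Union>n. ?C n)" by blast
  qed
  ultimately show ?thesis by (rule meager_subset)
qed

section \<open>Transfinite stages and runs\<close>

unbundle cardinal_syntax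

text \<open>A well-ordered type of more than continuum size: every well-order on \<^typ>\<open>nat set\<close>, hence the time
  line of every halting computation, embeds in it as a proper initial segment.\<close>

typedef stage = "UNIV :: nat set set set" by auto

instantiation stage :: wellorder
begin

definition less_eq_stage :: "stage \<Rightarrow> stage \<Rightarrow> bool" where
  "s \<le> t \<longleftrightarrow> (Rep_stage s, Rep_stage t) \<in> |UNIV :: nat set set set|"

definition less_stage :: "stage \<Rightarrow> stage \<Rightarrow> bool" where
  "(s::stage) < t \<longleftrightarrow> s \<le> t \<and> s \<noteq> t"

instance
proof
  let ?r = "|UNIV :: nat set set set|"
  have wo: "well_order_on UNIV ?r" by (rule card_of_well_order_on)
  then have lin: "refl ?r" "trans ?r" "antisym ?r" "total ?r"
    unfolding well_order_on_def linear_order_on_def partial_order_on_def preorder_on_def by auto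
  fix s t u :: stage
  show anti: "s = t" if "s \<le> t" "t \<le> s" for s t :: stage
    using that lin(3) unfolding less_eq_stage_def by (metis antisymD Rep_stage_inject)
  show "s < t \<longleftrightarrow> s \<le> t \<and> \<not> t \<le> s"
    unfolding less_stage_def using anti lin(1) by (auto simp: less_eq_stage_def refl_on_def)
  show "s \<le> s" using lin(1) by (simp add: less_eq_stage_def refl_on_def)
  show "s \<le> t \<Longrightarrow> t \<le> u \<Longrightarrow> s \<le> u"
    using lin(2) unfolding less_eq_stage_def by (meson transD)
  show "s \<le> t \<or> t \<le> s"
    using lin(1,4) unfolding less_eq_stage_def total_on_def refl_on_def by (metis UNIV_I)
  fix Q :: "stage \<Rightarrow> bool" and a :: stage
  assume step: "\<And>x. (\<And>y. y < x \<Longrightarrow> Q y) \<Longrightarrow> Q x"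
  have "wf (inv_image (?r - Id) Rep_stage)"
    using wo unfolding well_order_on_def by (intro wf_inv_image) auto
  then show "Q a"
  proof (induction a rule: wf_induct_rule)
    case (less x)
    show ?case
      by (rule step, rule less)
        (auto simp: less_stage_def less_eq_stage_def Rep_stage_inject)
  qed
qed

end

abbreviation stage_rel :: "stage rel" where "stage_rel \<equiv> {(s, t). s \<le> t}"

lemma Field_stage_rel [simp]: "Field stage_rel = UNIV"
  by (auto simp: Field_def)

section \<open>Ranks of well-orders as stages\<close>

lemma Well_order_card_less:
  assumes "Well_order r" "|Field r| <o |A|"
  shows "r <o |A|"
proof (rule ccontr)
  assume "\<not> r <o |A|"
  then have "|A| \<le>o r" using assms(1) by (simp add: card_of_Well_order not_ordLess_iff_ordLeq)
  then have "|A| \<le>o |Field r|" using card_of_mono2[of "|A|" r] by (simp add: Field_card_of)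
  then show False using assms(2) not_ordLess_ordLeq by blast
qed

text \<open>A well-order on a field of smaller cardinality lies below the cardinal order of
  \<open>stage\<close>, hence embeds in it as a proper initial segment. The map
  \<open>\<phi>\<close> serves as a rank function, both for time lines and for coded
  well-orders.\<close>

lemma embed_stage:
  fixes r :: "'a rel"
  assumes r: "Well_order r" and small: "|Field r| <o |UNIV :: nat set set set|"
  obtains \<phi> :: "'a \<Rightarrow> stage"
  where "\<And>x y. x \<in> Field r \<Longrightarrow> y \<in> Field r \<Longrightarrow> (x, y) \<in> r \<longleftrightarrow> \<phi> x \<le> \<phi> y"
    and "\<And>x t. x \<in> Field r \<Longrightarrow> t < \<phi> x \<Longrightarrow> \<exists>y\<in>Field r. \<phi> y = t"
    and "\<phi> ` Field r \<noteq> UNIV"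
proof -
  let ?R = "|UNIV :: nat set set set|"
  have less: "r <o ?R" using Well_order_card_less[OF r small] .
  then obtain f where f: "embed r ?R f"
    unfolding ordLess_def embedS_def by blast
  have ne: "f ` Field r \<noteq> UNIV" using BNF_Wellorder_Constructions.ordLess_Field[OF less f] by (simp add: Field_card_of)
  define \<phi> where "\<phi> x = Abs_stage (f x)" for x
  have Rep: "Rep_stage (\<phi> x) = f x" for x unfolding \<phi>_def by (simp add: Abs_stage_inverse)
  have bij: "bij_betw f (under r x) (under ?R (f x))" if "x \<in> Field r" for x
    using f that unfolding embed_def by blast
  have inj: "inj_on f (Field r)" using embed_inj_on[OF r f] .
  show thesis
  proof
    fix x y assume x: "x \<in> Field r" and y: "y \<in> Field r"
    show "(x, y) \<in> r \<longleftrightarrow> \<phi> x \<le> \<phi> y"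
    proof
      assume "(x, y) \<in> r"
      then show "\<phi> x \<le> \<phi> y" using bij[OF y] unfolding less_eq_stage_def Rep
        by (auto simp: bij_betw_def under_def)
    next
      assume "\<phi> x \<le> \<phi> y"
      then have "f x \<in> under ?R (f y)" unfolding less_eq_stage_def Rep under_def by simp
      then obtain z where z: "z \<in> under r y" "f z = f x" using bij[OF y] unfolding bij_betw_def by (metis imageE)
      then have "z \<in> Field r" by (auto simp: under_def Field_def)
      then have "z = x" using inj x z(2) by (auto dest: inj_onD)
      then show "(x, y) \<in> r" using z(1) by (simp add: under_def)
    qed
  next
    fix x t assume x: "x \<in> Field r" and t: "t < \<phi> x"
    then have "Rep_stage t \<in> under ?R (f x)"
      by (simp add: less_stage_def less_eq_stage_def Rep under_def)
    then obtain z where z: "z \<in> under r x" "f z = Rep_stage t" using bij[OF x] unfolding bij_betw_def by (metis imageE)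
    then have "z \<in> Field r" by (auto simp: under_def Field_def)
    moreover have "\<phi> z = t" using z(2) by (simp add: \<phi>_def Rep_stage_inverse)
    ultimately show "\<exists>y\<in>Field r. \<phi> y = t" by blast
  next
    obtain a where a: "a \<notin> f ` Field r" using ne by blast
    have "Abs_stage a \<notin> \<phi> ` Field r"
      using a unfolding \<phi>_def by (auto simp: Abs_stage_inject)
    then show "\<phi> ` Field r \<noteq> UNIV" by blast
  qed
qed

lemma card_nat_set_less_stage:
  fixes A :: "nat set set" shows "|A| <o |UNIV :: nat set set set|"
proof -
  have "|A| \<le>o |UNIV :: nat set set|" by (rule card_of_mono1) simp
  also have "|UNIV :: nat set set| <o |Pow (UNIV :: nat set set)|" by (rule card_of_Pow)
  finally show ?thesis by simp
qed

lemma card_nat_less_stage: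
  fixes A :: "nat set" shows "|A| <o |UNIV :: nat set set set|"
proof -
  have "|A| \<le>o |UNIV :: nat set|" by (rule card_of_mono1) simp
  also have "|UNIV :: nat set| <o |Pow (UNIV :: nat set)|" by (rule card_of_Pow)
  also have "|Pow (UNIV :: nat set)| <o |UNIV :: nat set set set|" by (rule card_nat_set_less_stage)
  finally show ?thesis .
qed

text \<open>A stage missed by an embedding of the uncountable type \<open>nat set\<close> lies above
  the whole image.\<close>

lemma ex_uncountable_stage: "\<exists>t::stage. uncountable {..<t}"
proof -
  let ?r = "|UNIV :: nat set set|"
  have F: "Field ?r = UNIV" by (rule Field_card_of)
  obtain \<phi> :: "nat set \<Rightarrow> stage" where \<phi>': "\<And>x y. x \<in> Field ?r \<Longrightarrow> y \<in> Field ?r \<Longrightarrow> (x, y) \<in> ?r \<longleftrightarrow> \<phi> x \<le> \<phi> y"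
    "\<And>x t. x \<in> Field ?r \<Longrightarrow> t < \<phi> x \<Longrightarrow> \<exists>y\<in>Field ?r. \<phi> y = t" "\<phi> ` Field ?r \<noteq> UNIV"
    by (rule embed_stage[OF card_of_Well_order card_nat_set_less_stage]) blast
  have \<phi>: "\<And>x y. (x, y) \<in> ?r \<longleftrightarrow> \<phi> x \<le> \<phi> y" "\<And>x t. t < \<phi> x \<Longrightarrow> \<exists>y. \<phi> y = t" "range \<phi> \<noteq> UNIV"
    using \<phi>' unfolding F by blast+
  then obtain t where t: "t \<notin> range \<phi>" by blast
  have "range \<phi> \<subseteq> {..<t}"
  proof safe
    fix x show "\<phi> x < t" using \<phi>(2)[of t x] t by (metis not_less_iff_gr_or_eq rangeI)
  qed
  moreover have "inj \<phi>"
  proof (rule injI)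
    fix x y assume eq: "\<phi> x = \<phi> y"
    have "antisym ?r" using card_of_Well_order
      unfolding well_order_on_def linear_order_on_def partial_order_on_def by blast
    moreover have "(x, y) \<in> ?r" "(y, x) \<in> ?r" using eq unfolding \<phi>(1) by simp_all
    ultimately show "x = y" by (rule antisymD)
  qed
  moreover have "uncountable (UNIV :: nat set set)"
    using Cantors_theorem[of "UNIV :: nat set"] range_from_nat_into[of "UNIV :: nat set set"]
    by (metis Pow_UNIV UNIV_not_empty)
  ultimately show ?thesis
    by (metis countable_image_inj_eq countable_subset)
qed

section \<open>The first uncountable stage\<close>

definition omega1 :: stage where "omega1 = (LEAST t. uncountable {..<t})"

lemma uncountable_omega1: "uncountable {..< omega1}"
  unfolding omega1_def using ex_uncountable_stage by (rule LeastI_ex)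

lemma countable_lessThan_stage: "t < omega1 \<Longrightarrow> countable {..<t}"
  unfolding omega1_def using not_less_Least by blast

text \<open>Regularity of the first uncountable ordinal: otherwise countably many countable initial
  segments would cover an uncountable one.\<close>

lemma countable_bounded_omega1:
  assumes "countable S" "\<And>s. s \<in> S \<Longrightarrow> s < omega1"
  shows "\<exists>t < omega1. \<forall>s\<in>S. s < t"
proof (rule ccontr)
  assume *: "\<not> ?thesis"
  have "{..< omega1} \<subseteq> (\<Union>s\<in>S. insert s {..<s})"
  proof
    fix t assume "t \<in> {..< omega1}"
    then have "\<not> (\<forall>s\<in>S. s < t)" using * by blast
    then obtain s where "s \<in> S" "t \<le> s" by (auto simp: not_less)
    then show "t \<in> (\<Union>s\<in>S. insert s {..<s})" by (auto simp: le_less)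
  qed
  moreover have "countable (\<Union>s\<in>S. insert s {..<s})"
    using assms countable_lessThan_stage by auto
  ultimately show False using uncountable_omega1 countable_subset by blast
qed

section \<open>Runs of machines along the stages\<close>

lemma lt_in_stage [simp]: "lt_in stage_rel s t \<longleftrightarrow> s < t"
  by (auto simp: lt_in_def)

lemma is_least_in_stage [simp]: "is_least_in stage_rel t \<longleftrightarrow> (\<forall>s. t \<le> s)"
  by (simp add: is_least_in_def)

lemma immediate_pred_stage:
  "immediate_pred stage_rel s t \<longleftrightarrow> s < t \<and> (\<forall>u. \<not> (s < u \<and> u < t))"
  by (simp add: immediate_pred_def)

lemma is_limit_in_stage:
  "is_limit_in stage_rel t \<longleftrightarrow> (\<exists>s. s < t) \<and> (\<forall>s<t. \<exists>u. s < u \<and> u < t)"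
  by (auto simp: is_limit_in_def immediate_pred_stage not_le)

lemma limsup_before_stage:
  "limsup_before stage_rel t f \<longleftrightarrow> (\<forall>s<t. \<exists>u. s \<le> u \<and> u < t \<and> f u)"
  by (simp add: limsup_before_def)

lemma immediate_pred_stage_unique:
  "immediate_pred stage_rel s t \<Longrightarrow> immediate_pred stage_rel s' t \<Longrightarrow> s = s'"
  unfolding immediate_pred_stage by (metis linorder_neqE)

text \<open>Halting is ignored: the recursion continues after the halt state, so every stage has a
  configuration.\<close>

definition run :: "prog \<Rightarrow> cantor \<Rightarrow> stage \<Rightarrow> config" where
  "run P w = wfrec {(s, t). s < t} (\<lambda>c t.
     if is_least_in stage_rel t then init_config w
     else if \<exists>s. immediate_pred stage_rel s t then step P (c (THE s. immediate_pred stage_rel s t))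
     else limit_config stage_rel t c)"

lemma limit_config_eqI:
  assumes "\<And>f. limsup_before r t (\<lambda>u. f (c u)) = limsup_before r' t' (\<lambda>u. f (c' u))"
  shows "limit_config r t c = limit_config r' t' c'"
  unfolding limit_config_def
  using assms[of "\<lambda>d. inp d _"] assms[of "\<lambda>d. scr d _"] assms[of "\<lambda>d. out d _"] by simp

lemma limit_config_cong:
  assumes "\<And>u. u < t \<Longrightarrow> c u = c' u"
  shows "limit_config stage_rel t c = limit_config stage_rel t c'"
proof -
  have "(\<exists>u. s \<le> u \<and> u < t \<and> f (c u)) = (\<exists>u. s \<le> u \<and> u < t \<and> f (c' u))" for s and f :: "config \<Rightarrow> bool"
    using assms by metis
  then show ?thesis
    by (intro limit_config_eqI) (simp add: limsup_before_stage)
qed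

lemma run_unfold:
  "run P w t = (if is_least_in stage_rel t then init_config w
     else if \<exists>s. immediate_pred stage_rel s t then step P (run P w (THE s. immediate_pred stage_rel s t))
     else limit_config stage_rel t (run P w))"
proof -
  let ?R = "{(s, t). s < t} :: stage rel"
  have wf: "wf ?R" by (rule wf)
  have the: "(THE s. immediate_pred stage_rel s t) < t" if "\<exists>s. immediate_pred stage_rel s t"
    using that immediate_pred_stage_unique by (metis immediate_pred_stage theI)
  have lim: "limit_config stage_rel t (cut (run P w) ?R t) = limit_config stage_rel t (run P w)"
    by (rule limit_config_cong) (simp add: cut_apply)
  show ?thesis
    by (subst run_def, subst wfrec[OF wf], fold run_def)
      (use the in \<open>simp add: lim cut_apply\<close>)
qed

lemma run_least: "(\<And>s. t \<le> s) \<Longrightarrow> run P w t = init_config w"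
  by (simp add: run_unfold[of P w t])

lemma run_succ:
  assumes "immediate_pred stage_rel s t" shows "run P w t = step P (run P w s)"
proof -
  have "(THE s. immediate_pred stage_rel s t) = s"
    using assms immediate_pred_stage_unique by (intro the_equality) auto
  moreover have "\<not> is_least_in stage_rel t" using assms by (auto simp: immediate_pred_stage not_le)
  ultimately show ?thesis using assms by (simp only: run_unfold[of P w t] if_False if_True) auto
qed

lemma run_limit: "is_limit_in stage_rel t \<Longrightarrow> run P w t = limit_config stage_rel t (run P w)"
  unfolding is_limit_in_def by (subst run_unfold) (simp del: is_least_in_stage)

text \<open>Induction on the rank. Being an isomorphism onto an initial segment,
  \<open>\<phi>\<close> preserves least elements, immediate predecessors, limits and the limsup
  taken at them.\<close>

lemma ittm_run_eq_run:
  fixes r :: "'t rel" and \<phi> :: "'t \<Rightarrow> stage"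
  assumes ittm: "ittm_run r c P w"
    and ord: "\<And>x y. x \<in> Field r \<Longrightarrow> y \<in> Field r \<Longrightarrow> (x, y) \<in> r \<longleftrightarrow> \<phi> x \<le> \<phi> y"
    and init: "\<And>x t. x \<in> Field r \<Longrightarrow> t < \<phi> x \<Longrightarrow> \<exists>y\<in>Field r. \<phi> y = t"
    and x: "x \<in> Field r"
  shows "c x = run P w (\<phi> x)"
proof -
  have wo: "Well_order r" using ittm unfolding ittm_run_def by blast
  have anti: "antisym r" using wo
    unfolding well_order_on_def linear_order_on_def partial_order_on_def by blast
  have inj: "x = y" if "x \<in> Field r" "y \<in> Field r" "\<phi> x = \<phi> y" for x y
    using that ord anti by (metis antisymD order_refl)
  have lt: "lt_in r x y \<longleftrightarrow> \<phi> x < \<phi> y" if "x \<in> Field r" "y \<in> Field r" for x y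
    using ord[OF that] inj[OF that] unfolding lt_in_def by (auto simp: less_le)
  show ?thesis using x
  proof (induction "\<phi> x" arbitrary: x rule: less_induct)
    case less
    note x = less.prems
    have IH: "c u = run P w (\<phi> u)" if "u \<in> Field r" "\<phi> u < \<phi> x" for u
      using less.hyps that by blast
    consider "is_least_in r x" | s where "immediate_pred r s x" | "is_limit_in r x"
      unfolding is_limit_in_def by blast
    then show ?case
    proof cases
      case 1
      have "\<phi> x \<le> t" for t
      proof (rule ccontr)
        assume "\<not> \<phi> x \<le> t"
        then obtain y where "y \<in> Field r" "\<phi> y = t" "t < \<phi> x" using init[OF x] by (auto simp: not_le)
        then show False using 1 ord[of x y] x unfolding is_least_in_def by auto
      qed
      then show ?thesis using ittm x 1 unfolding ittm_run_def by (simp add: run_least)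
    next
      case 2
      have s: "s \<in> Field r" "\<phi> s < \<phi> x" using 2 lt x unfolding immediate_pred_def by auto
      have "immediate_pred stage_rel (\<phi> s) (\<phi> x)"
        unfolding immediate_pred_stage
      proof (intro conjI allI notI s)
        fix u assume u: "\<phi> s < u \<and> u < \<phi> x"
        then obtain y where "y \<in> Field r" "\<phi> y = u" using init[OF x] by blast
        then show False using 2 u lt s x unfolding immediate_pred_def by auto
      qed
      then have "run P w (\<phi> x) = step P (run P w (\<phi> s))" by (rule run_succ)
      moreover have "c x = step P (c s)" using ittm x 2 unfolding ittm_run_def by blast
      ultimately show ?thesis using IH[OF s] by simp
    next
      case 3
      have "is_limit_in stage_rel (\<phi> x)"
        unfolding is_limit_in_stage
      proof (intro conjI allI impI)
        obtain s where s: "s \<in> Field r" "(x, s) \<notin> r"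
          using 3 unfolding is_limit_in_def is_least_in_def by blast
        then show "\<exists>s. s < \<phi> x" using ord[OF x s(1)] by (auto simp: not_le)
      next
        fix t assume t: "t < \<phi> x"
        then obtain s where s: "s \<in> Field r" "\<phi> s = t" using init[OF x] by blast
        then have "\<not> immediate_pred r s x" using 3 unfolding is_limit_in_def by blast
        then obtain u where "u \<in> Field r" "lt_in r s u" "lt_in r u x"
          using s t lt x unfolding immediate_pred_def by blast
        then show "\<exists>u. t < u \<and> u < \<phi> x" using lt s x by blast
      qed
      then have run: "run P w (\<phi> x) = limit_config stage_rel (\<phi> x) (run P w)" by (rule run_limit)
      have c: "c x = limit_config r x c" using ittm x 3 unfolding ittm_run_def by blast
      have "limsup_before r x (\<lambda>u. f (c u)) = limsup_before stage_rel (\<phi> x) (\<lambda>u. f (run P w u))"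
        for f :: "config \<Rightarrow> bool"
      proof
        assume L: "limsup_before r x (\<lambda>u. f (c u))"
        show "limsup_before stage_rel (\<phi> x) (\<lambda>u. f (run P w u))"
          unfolding limsup_before_stage
        proof (intro allI impI)
          fix t assume "t < \<phi> x"
          then obtain s where s: "s \<in> Field r" "\<phi> s = t" "lt_in r s x"
            using init[OF x] lt x by blast
          then obtain u where "u \<in> Field r" "(s, u) \<in> r" "lt_in r u x" "f (c u)"
            using L unfolding limsup_before_def by blast
          then show "\<exists>u. t \<le> u \<and> u < \<phi> x \<and> f (run P w u)"
            using IH[of u] lt ord s x by auto
        qed
      next
        assume R: "limsup_before stage_rel (\<phi> x) (\<lambda>u. f (run P w u))"
        show "limsup_before r x (\<lambda>u. f (c u))"
          unfolding limsup_before_def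
        proof (intro ballI impI)
          fix s assume s: "s \<in> Field r" "lt_in r s x"
          then obtain t where t: "\<phi> s \<le> t" "t < \<phi> x" "f (run P w t)"
            using R lt x unfolding limsup_before_stage by blast
          then obtain u where u: "u \<in> Field r" "\<phi> u = t" using init[OF x] by blast
          then have "(s, u) \<in> r" "lt_in r u x" "f (c u)" using t s x ord lt IH by auto
          then show "\<exists>u\<in>Field r. (s, u) \<in> r \<and> lt_in r u x \<and> f (c u)" using u by blast
        qed
      qed
      then show ?thesis unfolding c run by (intro limit_config_eqI)
    qed
  qed
qed

text \<open>As \<open>run\<close> continues after halting, the halting time has to be the first
  visit to the halt state.\<close>

definition halts_at :: "prog \<Rightarrow> cantor \<Rightarrow> stage \<Rightarrow> bool" where
  "halts_at P w t \<longleftrightarrow> st (run P w t) = halt_state \<and> (\<forall>s<t. st (run P w s) \<noteq> halt_state)"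

lemma halts_at_unique: "halts_at P w s \<Longrightarrow> halts_at P w t \<Longrightarrow> s = t"
  unfolding halts_at_def by (metis linorder_neqE)

lemma halts_with_imp_halts_at:
  assumes "halts_with P w y"
  shows "\<exists>t. halts_at P w t \<and> out (run P w t) = y"
proof -
  obtain r :: "nat set rel" and c m where r: "ittm_run r c P w" "m \<in> Field r"
    "\<forall>s\<in>Field r. (s, m) \<in> r" "st (c m) = halt_state" "out (c m) = y"
    using assms unfolding halts_with_def by blast
  have wo: "Well_order r" using r(1) unfolding ittm_run_def by blast
  obtain \<phi> :: "nat set \<Rightarrow> stage"
    where \<phi>: "\<And>x y. x \<in> Field r \<Longrightarrow> y \<in> Field r \<Longrightarrow> (x, y) \<in> r \<longleftrightarrow> \<phi> x \<le> \<phi> y"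
      "\<And>x t. x \<in> Field r \<Longrightarrow> t < \<phi> x \<Longrightarrow> \<exists>y\<in>Field r. \<phi> y = t"
    by (rule embed_stage[OF wo card_nat_set_less_stage]) metis
  have eq: "c x = run P w (\<phi> x)" if "x \<in> Field r" for x
    by (rule ittm_run_eq_run[OF r(1) _ _ that]; rule \<phi>; assumption)
  \<comment> \<open>In an \<open>ittm_run\<close> a halting time is the last one, which excludes an
    earlier visit.\<close>
  have "st (run P w s) \<noteq> halt_state" if s: "s < \<phi> m" for s
  proof
    assume h: "st (run P w s) = halt_state"
    obtain x where x: "x \<in> Field r" "\<phi> x = s" using \<phi>(2)[OF r(2) s] by blast
    then have "(m, x) \<in> r" using r(1,2) h eq[OF x(1)] unfolding ittm_run_def by auto
    then show False using \<phi>(1)[OF r(2) x(1)] x(2) s by simp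
  qed
  then show ?thesis unfolding halts_at_def using eq[OF r(2)] r(4,5) by auto
qed

section \<open>Repetition of configurations\<close>

text \<open>In ordinal terms \<open>\<phi>\<close> sends \<open>v + x\<close> to
  \<open>g + x\<close>: each value is the least stage from \<open>g\<close> on that exceeds all
  earlier values.\<close>

lemma shift_stage:
  fixes g v :: stage
  assumes gv: "g \<le> v"
  obtains \<phi> where "\<phi> v = g" "\<And>x y. v \<le> x \<Longrightarrow> x < y \<Longrightarrow> \<phi> x < \<phi> y"
    "\<And>x y. v \<le> x \<Longrightarrow> g \<le> y \<Longrightarrow> y < \<phi> x \<Longrightarrow> \<exists>x'. v \<le> x' \<and> x' < x \<and> \<phi> x' = y"
proof -
  let ?R = "{(s, t). s < t} :: stage rel"
  define \<phi> where "\<phi> = wfrec ?R (\<lambda>f x. LEAST y. g \<le> y \<and> (\<forall>x'. v \<le> x' \<and> x' < x \<longrightarrow> f x' < y))"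
  have unf: "\<phi> x = (LEAST y. g \<le> y \<and> (\<forall>x'. v \<le> x' \<and> x' < x \<longrightarrow> \<phi> x' < y))" for x
  proof -
    have "\<phi> x = (LEAST y. g \<le> y \<and> (\<forall>x'. v \<le> x' \<and> x' < x \<longrightarrow> cut \<phi> ?R x x' < y))"
      unfolding \<phi>_def by (subst wfrec) (auto intro: wf)
    moreover have "(\<forall>x'. v \<le> x' \<and> x' < x \<longrightarrow> cut \<phi> ?R x x' < y) \<longleftrightarrow> (\<forall>x'. v \<le> x' \<and> x' < x \<longrightarrow> \<phi> x' < y)" for y
      by (auto simp: cut_apply)
    ultimately show ?thesis by simp
  qed
  \<comment> \<open>Because \<open>g \<le> v\<close>, the stage \<open>x\<close> is itself a
    candidate, so the \<open>LEAST\<close> is attained.\<close>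
  have le: "\<phi> x \<le> x" if "v \<le> x" for x using that
  proof (induction x rule: less_induct)
    case (less x)
    have "g \<le> x \<and> (\<forall>x'. v \<le> x' \<and> x' < x \<longrightarrow> \<phi> x' < x)"
      using less gv by (meson le_less_trans order_trans)
    then show ?case by (subst unf) (rule Least_le)
  qed
  have props: "g \<le> \<phi> x \<and> (\<forall>x'. v \<le> x' \<and> x' < x \<longrightarrow> \<phi> x' < \<phi> x)" if "v \<le> x" for x
  proof -
    have "g \<le> x \<and> (\<forall>x'. v \<le> x' \<and> x' < x \<longrightarrow> \<phi> x' < x)"
      using that gv le by (meson le_less_trans order_trans)
    then show ?thesis
      using LeastI[of "\<lambda>y. g \<le> y \<and> (\<forall>x'. v \<le> x' \<and> x' < x \<longrightarrow> \<phi> x' < y)" x] unf[of x] by simp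
  qed
  show thesis
  proof
    have "(LEAST y. g \<le> y \<and> (\<forall>x'. v \<le> x' \<and> x' < v \<longrightarrow> \<phi> x' < y)) = g"
      by (rule Least_equality) auto
    then show "\<phi> v = g" using unf[of v] by simp
    show "\<phi> x < \<phi> y" if "v \<le> x" "x < y" for x y using props[of y] that by auto
    show "\<exists>x'. v \<le> x' \<and> x' < x \<and> \<phi> x' = y" if "v \<le> x" "g \<le> y" "y < \<phi> x" for x y
      using that
    proof (induction x rule: less_induct)
      case (less x)
      have "\<not> (g \<le> y \<and> (\<forall>x'. v \<le> x' \<and> x' < x \<longrightarrow> \<phi> x' < y))"
        using not_less_Least[of y "\<lambda>y. g \<le> y \<and> (\<forall>x'. v \<le> x' \<and> x' < x \<longrightarrow> \<phi> x' < y)"]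
          less.prems(3) unf[of x] by metis
      then obtain x' where x': "v \<le> x'" "x' < x" "y \<le> \<phi> x'" using less.prems by (auto simp: not_less)
      show ?case
      proof (cases "y = \<phi> x'")
        case True then show ?thesis using x' by auto
      next
        case False
        then show ?thesis using less.IH[of x'] x' less.prems by (meson less_trans le_less)
      qed
    qed
  qed
qed

text \<open>A configuration determines everything after it. At limits this holds because a limsup
  depends only on a final segment, so the stages before \<open>v\<close> and before \<open>g\<close>
  do not matter.\<close>

lemma run_shift:
  fixes g v :: stage
  assumes same: "run P w v = run P w g"
    and \<phi>: "\<phi> v = g" "\<And>x y. v \<le> x \<Longrightarrow> x < y \<Longrightarrow> \<phi> x < \<phi> y"
    "\<And>x y. v \<le> x \<Longrightarrow> g \<le> y \<Longrightarrow> y < \<phi> x \<Longrightarrow> \<exists>x'. v \<le> x' \<and> x' < x \<and> \<phi> x' = y"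
    and x: "v \<le> x"
  shows "run P w (\<phi> x) = run P w x"
  using x
proof (induction x rule: less_induct)
  case (less x)
  have ge: "g \<le> \<phi> y" if "v \<le> y" for y using \<phi>(1,2) that by (metis le_less)
  have less_iff: "\<phi> y < \<phi> z \<longleftrightarrow> y < z" if "v \<le> y" "v \<le> z" for y z
    using \<phi>(2) that by (metis less_imp_not_less linorder_neqE)
  show ?case
  proof (cases "x = v")
    case True then show ?thesis using same \<phi>(1) by simp
  next
    case False
    then have vx: "v < x" using less.prems by simp
    consider s where "immediate_pred stage_rel s x" | "is_limit_in stage_rel x"
      using vx unfolding is_limit_in_def by (auto simp: not_le)
    then show ?thesis
    proof cases
      case 1
      then have s: "v \<le> s" "s < x" using vx unfolding immediate_pred_stage by (auto simp: not_less)
      have "immediate_pred stage_rel (\<phi> s) (\<phi> x)"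
        unfolding immediate_pred_stage
      proof (intro conjI allI notI)
        show "\<phi> s < \<phi> x" using s \<phi>(2) by blast
        fix u assume u: "\<phi> s < u \<and> u < \<phi> x"
        then obtain x' where "v \<le> x'" "x' < x" "\<phi> x' = u"
          using \<phi>(3)[OF less.prems, of u] ge[OF s(1)] by (meson le_less_trans less_imp_le)
        then show False using 1 u less_iff[of s x'] s unfolding immediate_pred_stage by blast
      qed
      then show ?thesis using run_succ 1 less.IH[OF s(2,1)] by simp
    next
      case 2
      have lim: "is_limit_in stage_rel (\<phi> x)"
        unfolding is_limit_in_stage
      proof (intro conjI allI impI)
        show "\<exists>s. s < \<phi> x" using \<phi>(2) vx by blast
        fix t assume t: "t < \<phi> x"
        show "\<exists>u>t. u < \<phi> x"
        proof (cases "t < g")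
          case True
          then show ?thesis using \<phi>(1,2) vx by blast
        next
          case False
          then obtain x' where x': "v \<le> x'" "x' < x" "\<phi> x' = t"
            using \<phi>(3)[OF less.prems, of t] t by (auto simp: not_less)
          then obtain u where "x' < u" "u < x" using 2 unfolding is_limit_in_stage by blast
          then show ?thesis using \<phi>(2) x' by (meson less_imp_le order_trans)
        qed
      qed
      have "limsup_before stage_rel (\<phi> x) (\<lambda>u. f (run P w u)) = limsup_before stage_rel x (\<lambda>u. f (run P w u))"
        for f :: "config \<Rightarrow> bool"
        unfolding limsup_before_stage
      proof (intro iffI allI impI)
        fix s assume L: "\<forall>s<\<phi> x. \<exists>u\<ge>s. u < \<phi> x \<and> f (run P w u)" and s: "s < x"
        \<comment> \<open>Raising \<open>s\<close> to at least \<open>v\<close> is harmless for a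
          limsup and brings it to where \<open>\<phi>\<close> is controlled.\<close>
        let ?s = "max s v"
        have "v \<le> ?s" "?s < x" using s vx by auto
        then obtain u where u: "\<phi> ?s \<le> u" "u < \<phi> x" "f (run P w u)" using L \<phi>(2) by blast
        then obtain x' where x': "v \<le> x'" "x' < x" "\<phi> x' = u"
          using \<phi>(3)[OF less.prems, of u] ge[OF \<open>v \<le> ?s\<close>] by (meson order_trans)
        have "?s \<le> x'" using u(1) x' less_iff[of x' ?s] by (auto simp: not_less[symmetric])
        then show "\<exists>u\<ge>s. u < x \<and> f (run P w u)" using x' less.IH[of x'] u(3) by auto
      next
        fix s assume R: "\<forall>s<x. \<exists>u\<ge>s. u < x \<and> f (run P w u)" and s: "s < \<phi> x"
        let ?s = "max s g"
        have "?s < \<phi> x" using s \<phi>(1,2) vx by (metis max_less_iff_conj order_refl)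
        then obtain x' where x': "v \<le> x'" "x' < x" "\<phi> x' = ?s"
          using \<phi>(3)[OF less.prems, of ?s] by auto
        then obtain u where u: "x' \<le> u" "u < x" "f (run P w u)" using R by blast
        then have "v \<le> u" using x' by simp
        have "?s \<le> \<phi> u" using less_iff[OF \<open>v \<le> u\<close> x'(1)] u(1) x'(3) by (metis not_less)
        then have "s \<le> \<phi> u" by simp
        then show "\<exists>u\<ge>s. u < \<phi> x \<and> f (run P w u)"
          using less.IH[OF u(2) \<open>v \<le> u\<close>] u \<phi>(2)[OF \<open>v \<le> u\<close> u(2)] by auto
      qed
      then show ?thesis unfolding run_limit[OF lim] run_limit[OF 2] by (intro limit_config_eqI)
    qed
  qed
qed

text \<open>The three tapes become one countable family of bits; every first index above 1 denotes
  the output tape.\<close>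

definition cell :: "config \<Rightarrow> nat \<times> nat \<Rightarrow> bool" where
  "cell c k = (if fst k = 0 then inp c (snd k) else if fst k = 1 then scr c (snd k) else out c (snd k))"

lemma cell_simps: "cell c (0, i) = inp c i" "cell c (Suc 0, i) = scr c i" "cell c (Suc (Suc 0), i) = out c i"
  by (auto simp: cell_def)

lemma config_eqI:
  fixes c c' :: config
  assumes "st c = st c'" "hd c = hd c'" "\<And>k. cell c k = cell c' k"
  shows "c = c'"
proof -
  have "inp c = inp c'" "scr c = scr c'" "out c = out c'"
    using assms(3)[of "(0, i)" for i] assms(3)[of "(Suc 0, i)" for i] assms(3)[of "(Suc (Suc 0), i)" for i]
    by (auto simp: cell_simps)
  then show ?thesis using assms(1,2) by simp
qed

lemma run_limit_simps:
  assumes "is_limit_in stage_rel t"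
  shows "st (run P w t) = limit_state" "hd (run P w t) = 0"
    "cell (run P w t) k \<longleftrightarrow> (\<forall>s<t. \<exists>u. s \<le> u \<and> u < t \<and> cell (run P w u) k)"
  using run_limit[OF assms, of P w] by (auto simp: limit_config_def cell_def limsup_before_stage)

text \<open>Equality of two configurations alone would not survive limits of repetitions. The
  hypothesis \<open>le\<close> ensures that it does: cells that are 1 at \<open>g\<close> recur at
  each return, and cells that are 0 there stay 0. So the run never leaves the configurations seen
  from \<open>g\<close> up to \<open>h\<close>.\<close>

lemma run_loop:
  assumes lim: "is_limit_in stage_rel g" and gh: "g < h"
    and eq: "run P w h = run P w g"
    and le: "\<And>u k. g \<le> u \<Longrightarrow> u < h \<Longrightarrow> cell (run P w u) k \<Longrightarrow> cell (run P w g) k"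
    and u: "g \<le> u"
  shows "\<exists>x. g \<le> x \<and> x < h \<and> run P w u = run P w x"
  using u
proof (induction u rule: less_induct)
  case (less u)
  let ?c = "run P w" and ?G = "{x. g \<le> x \<and> x < u \<and> run P w x = run P w g}"
  show ?case
  proof (cases "u < h")
    case True then show ?thesis using less.prems by blast
  next
    case False
    then have gu: "g < u" using gh by simp
    \<comment> \<open>A stage at which returns to the configuration of \<open>g\<close> accumulate
      is itself a return.\<close>
    have cofinal: "?c x = ?c g" if x: "x \<le> u" "g < x" and G: "\<And>s. s < x \<Longrightarrow> \<exists>y\<in>?G. s < y \<and> y < x" for x
    proof (rule config_eqI)
      have limx: "is_limit_in stage_rel x"
        unfolding is_limit_in_stage using G x by blast
      show "st (?c x) = st (?c g)" "hd (?c x) = hd (?c g)"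
        using run_limit_simps[OF limx] run_limit_simps[OF lim] by auto
      fix k
      show "cell (?c x) k = cell (?c g) k"
      proof
        assume "cell (?c x) k"
        then obtain y where y: "g \<le> y" "y < x" "cell (?c y) k"
          using run_limit_simps(3)[OF limx] x(2) by blast
        then obtain z where "g \<le> z" "z < h" "?c y = ?c z" using less.IH[of y] x(1) by (meson less_le_trans)
        then show "cell (?c g) k" using le[of z k] y(3) by auto
      next
        assume "cell (?c g) k"
        then show "cell (?c x) k" unfolding run_limit_simps(3)[OF limx]
          using G by (metis (mono_tags, lifting) less_imp_le mem_Collect_eq)
      qed
    qed
    show ?thesis
    proof (cases "\<forall>s<u. \<exists>y\<in>?G. s < y")
      case True
      then have "?c u = ?c g" using gu by (intro cofinal) auto
      then show ?thesis using gh by blast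
    next
      case False
      then obtain s where s: "s < u" "\<And>y. y \<in> ?G \<Longrightarrow> y \<le> s" by (meson not_less)
      \<comment> \<open>The supremum of the returns below \<open>u\<close>. It is again a return,
        and the run after it is compared with the run after \<open>g\<close>.\<close>
      define v where "v = (LEAST v. \<forall>y\<in>?G. y \<le> v)"
      have v: "y \<le> v" if "y \<in> ?G" for y
        using LeastI[of "\<lambda>v. \<forall>y\<in>?G. y \<le> v" s] s(2) that unfolding v_def by blast
      have "v \<le> s" unfolding v_def using s(2) by (intro Least_le) blast
      then have vu: "v < u" using s(1) by simp
      have gv: "g \<le> v" using v gu by blast
      have cv: "?c v = ?c g"
      proof (cases "v \<in> ?G")
        case True then show ?thesis by simp
      next
        case vG: False
        then have "g \<noteq> v" using gu vu by auto
        show ?thesis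
        proof (rule cofinal)
          show "v \<le> u" "g < v" using vu gv \<open>g \<noteq> v\<close> by auto
          fix s' assume "s' < v"
          then obtain y where "y \<in> ?G" "s' < y"
            using not_less_Least[of s' "\<lambda>v. \<forall>y\<in>?G. y \<le> v"] unfolding v_def by (auto simp: not_le)
          moreover have "y < v" using v[OF \<open>y \<in> ?G\<close>] vG \<open>y \<in> ?G\<close> by (metis le_less)
          ultimately show "\<exists>y\<in>?G. s' < y \<and> y < v" by blast
        qed
      qed
      obtain \<phi> where \<phi>: "\<phi> v = g" "\<And>x y. v \<le> x \<Longrightarrow> x < y \<Longrightarrow> \<phi> x < \<phi> y"
        "\<And>x y. v \<le> x \<Longrightarrow> g \<le> y \<Longrightarrow> y < \<phi> x \<Longrightarrow> \<exists>x'. v \<le> x' \<and> x' < x \<and> \<phi> x' = y"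
        using shift_stage[OF gv] by metis
      have sh: "?c (\<phi> x) = ?c x" if "v \<le> x" for x 
        by (rule run_shift[where \<phi> = \<phi>, OF cv _ _ _ that]; rule \<phi>; assumption)
      have gphi: "g \<le> \<phi> u" using \<phi>(1,2) vu by (metis less_imp_le order_refl)
      consider "\<phi> u < h" | "\<phi> u = h" | "h < \<phi> u" by fastforce
      then show ?thesis
      proof cases
        case 1 then show ?thesis using gphi sh[of u] vu by (metis less_imp_le)
      next
        case 2 then show ?thesis using sh[of u] vu eq gh by (metis less_imp_le order_refl)
      next
        \<comment> \<open>The stage \<open>x\<close> shifted to \<open>h\<close> would be a return,
          hence at most \<open>v\<close>; but \<open>v\<close> is shifted to
          \<open>g\<close>.\<close>
        case 3
        then obtain x where x: "v \<le> x" "x < u" "\<phi> x = h" using \<phi>(3)[of u h] vu gh by (meson less_imp_le)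
        then have "?c x = ?c g" using sh[of x] eq by simp
        then have "x \<le> v" using v x gv by auto
        then have "x = v" using x by simp
        then show ?thesis using x \<phi>(1) gh by simp
      qed
    qed
  qed
qed

section \<open>Generic computations\<close>

definition baire_config :: "('a::topological_space \<Rightarrow> config) \<Rightarrow> bool" where
  "baire_config c \<longleftrightarrow> (\<forall>q. baire_property {w. st (c w) = q}) \<and> (\<forall>h. baire_property {w. hd (c w) = h}) \<and>
     (\<forall>k. baire_property {w. cell (c w) k})"

lemma baire_config_init:
  assumes "\<And>i. baire_property {w. input w i}"
  shows "baire_config (\<lambda>w. init_config (input w))"
proof -
  have "baire_property {w. cell (init_config (input w)) k}" for k
    by (cases "fst k = 0") (auto simp: cell_def init_config_def assms baire_property_const)
  then show ?thesis unfolding baire_config_def by (auto simp: init_config_def baire_property_const)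
qed

text \<open>All that the next step reads. The value lies in a countable type, so any condition on it
  is a countable union of conditions on single values.\<close>

definition view :: "config \<Rightarrow> nat \<times> nat \<times> bool \<times> bool \<times> bool" where
  "view c = (st c, hd c, cell c (0, hd c), cell c (1, hd c), cell c (2, hd c))"

lemma baire_property_view:
  assumes "baire_config c" shows "baire_property {w. Q (view (c w))}"
proof -
  have "baire_property {w. view (c w) = v}" for v
  proof -
    obtain q h x y z where v: "v = (q, h, x, y, z)" by (cases v)
    have "{w. view (c w) = v} = {w. st (c w) = q \<and> hd (c w) = h \<and> (cell (c w) (0, h) \<longleftrightarrow> x) \<and>
       (cell (c w) (1, h) \<longleftrightarrow> y) \<and> (cell (c w) (2, h) \<longleftrightarrow> z)}"
      unfolding view_def v by auto
    then show ?thesis using assms unfolding baire_config_def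
      by (simp only:) (intro baire_property_conj baire_property_iff baire_property_const; blast)
  qed
  then have "baire_property {w. \<exists>v\<in>{v. Q v}. view (c w) = v}"
    by (intro baire_property_Bex) auto
  then show ?thesis by simp
qed

text \<open>One step is a function of the view together with an update of the scanned cells. In this
  form the Baire property passes to the next configuration by Boolean combinations alone.\<close>

lemma step_view:
  obtains q h and Q :: "nat \<Rightarrow> nat \<times> nat \<times> bool \<times> bool \<times> bool \<Rightarrow> bool"
  where "\<And>c. st (step P c) = q (view c)" "\<And>c. hd (step P c) = h (view c)"
    "\<And>c j i. cell (step P c) (j, i) \<longleftrightarrow> (hd c = i \<and> Q j (view c)) \<or> (hd c \<noteq> i \<and> cell c (j, i))"
proof -
  let ?d = "\<lambda>(s, h, x, y, z). delta P s x y z"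
  let ?w = "\<lambda>j v. (case ?d v of (_, w1, w2, w3, _) \<Rightarrow> if j = 0 then w1 else if j = Suc 0 then w2 else w3)"
  have d: "delta P (st c) (inp c (hd c)) (scr c (hd c)) (out c (hd c)) = ?d (view c)" for c
    by (simp add: view_def cell_def)
  show thesis
  proof
    show "st (step P c) = fst (?d (view c))" for c
      unfolding step_def Let_def d by (simp split: prod.split)
    show "hd (step P c) = (if snd (snd (snd (snd (?d (view c))))) then fst (snd (view c)) + 1 else fst (snd (view c)) - 1)" for c
      unfolding step_def Let_def d by (simp add: view_def split: prod.split)
    show "cell (step P c) (j, i) \<longleftrightarrow> (hd c = i \<and> ?w j (view c)) \<or> (hd c \<noteq> i \<and> cell c (j, i))" for c j i
      unfolding step_def Let_def d by (auto simp: cell_def split: prod.split)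
  qed
qed

lemma baire_config_step:
  assumes c: "baire_config c" shows "baire_config (\<lambda>w. step P (c w))"
proof -
  obtain q h and Q :: "nat \<Rightarrow> nat \<times> nat \<times> bool \<times> bool \<times> bool \<Rightarrow> bool"
    where *: "\<And>c. st (step P c) = q (view c)" "\<And>c. hd (step P c) = h (view c)"
    "\<And>c j i. cell (step P c) (j, i) \<longleftrightarrow> (hd c = i \<and> Q j (view c)) \<or> (hd c \<noteq> i \<and> cell c (j, i))"
    using step_view[of P] by metis
  have "baire_property {w. cell (step P (c w)) k}" for k
  proof -
    obtain j i where k: "k = (j, i)" by (cases k)
    show ?thesis
      unfolding k *
      using c baire_property_view[OF c] unfolding baire_config_def
      by (intro baire_property_conj baire_property_disj baire_property_not; blast)
  qed
  moreover have "baire_property {w. q (view (c w)) = x}" "baire_property {w. h (view (c w)) = x}" for x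
    using baire_property_view[OF c] by fast+
  ultimately show ?thesis unfolding baire_config_def * by blast
qed

text \<open>At a limit below \<open>omega1\<close> the limsup is a countable intersection of
  countable unions over earlier stages.\<close>

lemma baire_config_run:
  assumes input: "\<And>i. baire_property {w. input w i}" and t: "t < omega1"
  shows "baire_config (\<lambda>w. run P (input w) t)"
  using t
proof (induction t rule: less_induct)
  case (less t)
  consider "is_least_in stage_rel t" | s where "immediate_pred stage_rel s t" | "is_limit_in stage_rel t"
    unfolding is_limit_in_def by blast
  then show ?case
  proof cases
    case 1 then show ?thesis by (simp add: run_least baire_config_init input)
  next
    case 2
    then have "s < t" unfolding immediate_pred_stage by blast
    then show ?thesis using less run_succ[OF 2] by (simp add: baire_config_step)
  next
    case 3
    have IH: "baire_property {w. cell (run P (input w) u) k}" if "u < t" for u k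
      using less.IH[OF that] that less.prems unfolding baire_config_def by (meson less_trans)
    have ct: "countable {..<t}" using less.prems by (rule countable_lessThan_stage)
    have "baire_property {w. \<forall>s\<in>{..<t}. \<exists>u\<in>{u. s \<le> u \<and> u < t}. cell (run P (input w) u) k}" for k
      using IH ct by (intro baire_property_Ball baire_property_Bex) (auto intro: countable_subset[of _ "{..<t}"])
    then have "baire_property {w. cell (run P (input w) t) k}" for k
      unfolding run_limit_simps(3)[OF 3] Ball_def Bex_def by (simp only: mem_Collect_eq lessThan_iff conj_assoc)
    then show ?thesis
      unfolding baire_config_def using run_limit_simps(1,2)[OF 3] by (simp add: baire_property_const)
  qed
qed

text \<open>The bound is the second of two stages \<open>g < h\<close> at which generic
  configurations coincide; \<open>run_loop\<close> then excludes a later first visit to the halt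
  state.\<close>

lemma generic_halting_bound:
  fixes input :: "'a::second_countable_topology \<Rightarrow> cantor"
  assumes input: "\<And>i. baire_property {w. input w i}"
  shows "\<exists>d < omega1. meager {w. \<exists>t\<ge>d. halts_at P (input w) t}"
proof -
  define C where "C u k = {w. cell (run P (input w) u) k}" for u k
  have bp: "baire_property (C u k)" if "u < omega1" for u k
    using baire_config_run[of input, OF input that] unfolding baire_config_def C_def by blast
  \<comment> \<open>These countable sets decrease with \<open>t\<close>, so they are constant from
    some countable stage on.\<close>
  define V where "V t = {(b, k). \<exists>u. t \<le> u \<and> u < omega1 \<and> b \<in> forced (C u k)}" for t
  have V_mono: "V t \<subseteq> V s" if "s \<le> t" for s t
    unfolding V_def using that by (auto intro: order_trans)
  have cV: "countable (V t)" for t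
    by (rule countable_subset[of _ "basic \<times> UNIV"]) (auto simp: V_def forced_def countable_basic)
  have "\<exists>t0 < omega1. \<forall>t. t < omega1 \<longrightarrow> V t0 \<subseteq> V t"
  proof -
    \<comment> \<open>The pairs that disappear eventually; \<open>\<tau>\<close> chooses a stage at
      which each has disappeared, and \<open>t0\<close> bounds these stages.\<close>
    define D where "D = {p \<in> basic \<times> UNIV. \<exists>t < omega1. p \<notin> V t}"
    have "\<forall>p\<in>D. \<exists>t. t < omega1 \<and> p \<notin> V t" unfolding D_def by blast
    from bchoice[OF this] obtain \<tau> where \<tau>: "\<forall>p\<in>D. \<tau> p < omega1 \<and> p \<notin> V (\<tau> p)" ..
    have "countable (\<tau> ` D)"
      by (intro countable_image countable_subset[of D "basic \<times> UNIV"]) (auto simp: countable_basic D_def)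
    then obtain t0 where t0: "t0 < omega1" "\<forall>s\<in>\<tau> ` D. s < t0"
      using countable_bounded_omega1[of "\<tau> ` D"] \<tau> by blast
    have "p \<in> V t" if p: "p \<in> V t0" and t: "t < omega1" for p t
    proof (rule ccontr)
      assume "p \<notin> V t"
      moreover have "p \<in> basic \<times> UNIV" using p by (auto simp: V_def forced_def)
      ultimately have "p \<in> D" using t unfolding D_def by blast
      then have "p \<notin> V (\<tau> p)" "\<tau> p < t0" using \<tau> t0(2) by auto
      then show False using V_mono[OF less_imp_le, of "\<tau> p" t0] p by (meson subsetD)
    qed
    then show ?thesis using t0(1) by blast
  qed
  then obtain t0 where t0: "t0 < omega1" and stable: "\<And>t. t < omega1 \<Longrightarrow> V t0 \<subseteq> V t" by blast
  \<comment> \<open>The union of the basic sets forcing cell \<open>k\<close> to be 1 at arbitrarily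
    late countable stages. At suitable limits it turns out to be the value of the cell modulo a
    meager set.\<close>
  define W where "W k = \<Union>{b. (b, k) \<in> V t0}" for k
  have below_W: "meager (C u k - W k)" if "t0 \<le> u" "u < omega1" for u k
  proof (rule meager_subset[OF meager_diff_forced[OF bp[OF that(2)]]])
    have "\<Union>(forced (C u k)) \<subseteq> W k" unfolding W_def V_def using that by auto
    then show "C u k - W k \<subseteq> C u k - \<Union>(forced (C u k))" by blast
  qed
  \<comment> \<open>Every pair that is forced cofinally below \<open>omega1\<close> is already
    forced cofinally below a good stage.\<close>
  define good where "good g \<longleftrightarrow> is_limit_in stage_rel g \<and> g < omega1 \<and>
    (\<forall>p\<in>V t0. \<forall>s<g. \<exists>u. s \<le> u \<and> u < g \<and> fst p \<in> forced (C u (snd p)))" for g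
  have next_stage: "\<exists>t'. t' < omega1 \<and> t < t' \<and> (\<forall>p\<in>V t0. \<exists>u. t \<le> u \<and> u < t' \<and> fst p \<in> forced (C u (snd p)))"
    if t: "t < omega1" for t
  proof -
    have "\<forall>p\<in>V t0. \<exists>u. t \<le> u \<and> u < omega1 \<and> fst p \<in> forced (C u (snd p))"
      using stable[OF t] unfolding V_def by fastforce
    from bchoice[OF this] obtain \<mu> where \<mu>: "\<forall>p\<in>V t0. t \<le> \<mu> p \<and> \<mu> p < omega1 \<and> fst p \<in> forced (C (\<mu> p) (snd p))" ..
    obtain t' where "t' < omega1" "\<forall>s\<in>insert t (\<mu> ` V t0). s < t'"
      using countable_bounded_omega1[of "insert t (\<mu> ` V t0)"] \<mu> cV t by blast
    then show ?thesis using \<mu> by (intro exI[of _ t']) auto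
  qed
  then obtain nxt where nxt: "\<And>t. t < omega1 \<Longrightarrow> nxt t < omega1 \<and> t < nxt t \<and>
      (\<forall>p\<in>V t0. \<exists>u. t \<le> u \<and> u < nxt t \<and> fst p \<in> forced (C u (snd p)))" by metis
  have good_above: "\<exists>g. good g \<and> t < g" if t: "t < omega1" for t
  proof -
    \<comment> \<open>Between consecutive members of this sequence every pair of \<open>V t0\<close>
      is forced once, so its supremum is good.\<close>
    define \<tau> where "\<tau> n = (nxt ^^ n) t" for n
    have \<tau>: "\<tau> n < omega1" for n by (induction n) (auto simp: \<tau>_def t nxt)
    have \<tau>_Suc: "\<tau> (Suc n) = nxt (\<tau> n)" for n by (simp add: \<tau>_def)
    obtain b where b: "b < omega1" "\<forall>n. \<tau> n < b"
      using countable_bounded_omega1[of "range \<tau>"] \<tau> by blast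
    define g where "g = (LEAST g. \<forall>n. \<tau> n < g)"
    have g: "\<tau> n < g" for n using LeastI[of "\<lambda>g. \<forall>n. \<tau> n < g" b] b(2) unfolding g_def by blast
    have "g \<le> b" unfolding g_def using b(2) by (intro Least_le) blast
    then have g1: "g < omega1" using b(1) by simp
    have cof: "\<exists>n. s \<le> \<tau> n" if "s < g" for s
      using not_less_Least[of s "\<lambda>g. \<forall>n. \<tau> n < g"] that unfolding g_def by (meson not_less)
    have "is_limit_in stage_rel g"
      unfolding is_limit_in_stage
    proof (intro conjI allI impI)
      show "\<exists>s. s < g" using g by blast
      fix s assume "s < g"
      then obtain n where "s \<le> \<tau> n" using cof by blast
      then have "s < \<tau> (Suc n)" using nxt[OF \<tau>[of n]] unfolding \<tau>_Suc by (meson le_less_trans)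
      then show "\<exists>u>s. u < g" using g by blast
    qed
    moreover have "\<exists>u. s \<le> u \<and> u < g \<and> fst p \<in> forced (C u (snd p))" if p: "p \<in> V t0" and s: "s < g" for p s
    proof -
      obtain n where n: "s \<le> \<tau> n" using cof[OF s] by blast
      obtain u where "\<tau> n \<le> u" "u < \<tau> (Suc n)" "fst p \<in> forced (C u (snd p))"
        using nxt[OF \<tau>[of n]] p unfolding \<tau>_Suc by blast
      then show ?thesis using n g[of "Suc n"] by (meson less_trans order_trans)
    qed
    ultimately have "good g" unfolding good_def using g1 by blast
    moreover have "t < g" using g[of 0] by (simp add: \<tau>_def)
    ultimately show ?thesis by blast
  qed
  have W_below: "meager (W k - C g k)" if g: "good g" for g k
  proof -
    have "meager (b - C g k)" if b: "(b, k) \<in> V t0" for b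
    proof -
      have "\<forall>s\<in>{..<g}. \<exists>u. s \<le> u \<and> u < g \<and> b \<in> forced (C u k)"
        using g b unfolding good_def by fastforce
      from bchoice[OF this] obtain \<mu> where \<mu>: "\<forall>s\<in>{..<g}. s \<le> \<mu> s \<and> \<mu> s < g \<and> b \<in> forced (C (\<mu> s) k)" ..
      \<comment> \<open>Off this countable union, cell \<open>k\<close> is 1 at a stage from each
        \<open>s < g\<close> on, hence 1 in the limit configuration.\<close>
      have "meager (\<Union>s\<in>{..<g}. b - C (\<mu> s) k)"
      proof (rule meager_UN)
        show "countable {..<g}" by (rule countable_lessThan_stage) (use g in \<open>simp add: good_def\<close>)
        show "meager (b - C (\<mu> s) k)" if "s \<in> {..<g}" for s using \<mu> that unfolding forced_def by blast
      qed
      moreover have "b - C g k \<subseteq> (\<Union>s\<in>{..<g}. b - C (\<mu> s) k)"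
      proof
        fix w assume w: "w \<in> b - C g k"
        have lim: "is_limit_in stage_rel g" using g unfolding good_def by blast
        obtain s where s: "s < g" "\<forall>u. s \<le> u \<and> u < g \<longrightarrow> w \<notin> C u k"
          using w unfolding C_def by (auto simp: run_limit_simps(3)[OF lim])
        then have "w \<notin> C (\<mu> s) k" using \<mu> by blast
        then show "w \<in> (\<Union>s\<in>{..<g}. b - C (\<mu> s) k)" using w s(1) by blast
      qed
      ultimately show ?thesis by (rule meager_subset)
    qed
    moreover have "countable {b. (b, k) \<in> V t0}"
      by (rule countable_subset[OF _ countable_image[OF cV[of t0], of fst]]) force
    ultimately have "meager (\<Union>b\<in>{b. (b, k) \<in> V t0}. b - C g k)" by (intro meager_UN) auto
    then show ?thesis by (rule meager_subset) (auto simp: W_def)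
  qed
  obtain g where g: "good g" "t0 < g" using good_above[OF t0] by blast
  obtain h where h: "good h" "g < h" using good_above[of g] g(1) unfolding good_def by blast
  have g1: "g < omega1" and h1: "h < omega1" and limg: "is_limit_in stage_rel g" and limh: "is_limit_in stage_rel h"
    using g(1) h(1) unfolding good_def by auto
  \<comment> \<open>Outside \<open>M\<close> the cells at \<open>g\<close> and at \<open>h\<close>
    are given by \<open>W\<close>, and no cell outside \<open>W\<close> is 1 in between: the
    hypotheses of \<open>run_loop\<close>.\<close>
  define M where "M = (\<Union>k. (W k - C g k) \<union> (W k - C h k) \<union> (\<Union>u\<in>{g..h}. C u k - W k))"
  have M: "meager M"
    unfolding M_def
  proof (intro meager_UN meager_Un W_below g h)
    show "countable {g..h}"
      using countable_lessThan_stage[OF h1] by (rule countable_subset[rotated, OF countable_insert[of _ h]]) auto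
    show "meager (C u k - W k)" if "u \<in> {g..h}" for u k
      using that g(2) h1 by (intro below_W) auto
  qed simp
  have lt: "t < h" if w: "w \<notin> M" and t: "halts_at P (input w) t" for w t
  proof (rule ccontr)
    assume "\<not> t < h"
    then have gt: "g \<le> t" using h(2) by simp
    have in_W: "w \<in> W k" if "w \<in> C u k" "g \<le> u" "u \<le> h" for u k
    proof -
      have "w \<notin> (\<Union>u\<in>{g..h}. C u k - W k)" using w unfolding M_def by blast
      then show ?thesis using that by auto
    qed
    have W_in: "w \<in> C g k" "w \<in> C h k" if "w \<in> W k" for k using w that unfolding M_def by blast+
    have "run P (input w) h = run P (input w) g"
    proof (rule config_eqI)
      show "st (run P (input w) h) = st (run P (input w) g)" "hd (run P (input w) h) = hd (run P (input w) g)"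
        unfolding run_limit_simps(1,2)[OF limg] run_limit_simps(1,2)[OF limh] by (rule refl)+
      fix k
      have "g \<le> h" using h(2) by simp
      then have "w \<in> C h k \<longleftrightarrow> w \<in> C g k"
        using in_W[of h k] in_W[of g k] W_in[of k] by blast
      then show "cell (run P (input w) h) k = cell (run P (input w) g) k" by (simp add: C_def)
    qed
    moreover have "cell (run P (input w) g) k" if "g \<le> u" "u < h" "cell (run P (input w) u) k" for u k
      using in_W[of u k] W_in(1)[of k] that by (simp add: C_def)
    ultimately obtain x where "g \<le> x" "x < h" "run P (input w) t = run P (input w) x"
      using run_loop[OF limg h(2) _ _ gt] by blast
    then show False using t \<open>\<not> t < h\<close> unfolding halts_at_def by (metis less_le_trans not_less)
  qed
  have "meager {w. \<exists>t\<ge>h. halts_at P (input w) t}"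
  proof (rule meager_subset[OF M], safe)
    fix w t assume "h \<le> t" "halts_at P (input w) t"
    then show "w \<in> M" using lt[of w t] by (meson not_less)
  qed
  then show ?thesis using h1 by blast
qed

text \<open>Off a meager set the machine halts before a fixed countable stage \<open>d\<close>, so
  the output bit is decided by a countable union over halting times below \<open>d\<close>.\<close>

theorem baire_property_output:
  fixes input :: "'a::second_countable_topology \<Rightarrow> cantor"
  assumes input: "\<And>i. baire_property {w. input w i}"
    and halt: "\<And>w. halts_with P (input w) (g w)"
  shows "baire_property {w. g w i}"
proof -
  obtain d where d: "d < omega1" "meager {w. \<exists>t\<ge>d. halts_at P (input w) t}"
    using generic_halting_bound[of input, OF input] by blast
  let ?B = "{w. \<exists>t\<in>{..<d}. halts_at P (input w) t \<and> cell (run P (input w) t) (2, i)}"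
  have conf: "baire_config (\<lambda>w. run P (input w) t)" if "t < d" for t
    using baire_config_run[of input, OF input] that d(1) by (meson less_trans)
  have "baire_property {w. halts_at P (input w) t}" if t: "t < d" for t
  proof -
    have "baire_property {w. st (run P (input w) t) = halt_state \<and> (\<forall>s\<in>{..<t}. \<not> st (run P (input w) s) = halt_state)}"
      using conf t countable_lessThan_stage[of t] d(1) unfolding baire_config_def
      by (intro baire_property_conj baire_property_Ball baire_property_not) auto
    then show ?thesis by (simp add: halts_at_def Ball_def)
  qed
  then have B: "baire_property ?B"
    using conf countable_lessThan_stage[OF d(1)] unfolding baire_config_def
    by (intro baire_property_Bex baire_property_conj) auto
  have eq: "g w i \<longleftrightarrow> w \<in> ?B" if "w \<notin> {w. \<exists>t\<ge>d. halts_at P (input w) t}" for w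
  proof -
    obtain t where t: "halts_at P (input w) t" "out (run P (input w) t) = g w"
      using halts_with_imp_halts_at[OF halt] by blast
    have td: "t < d"
    proof (rule ccontr)
      assume "\<not> t < d"
      then have "d \<le> t" by simp
      then show False using that t(1) by blast
    qed
    have out: "cell (run P (input w) t) (2, i) = g w i" using t(2) by (simp add: cell_def)
    show ?thesis
    proof
      assume "g w i"
      then show "w \<in> ?B" using t(1) td out by blast
    next
      assume "w \<in> ?B"
      then obtain s where "halts_at P (input w) s" "cell (run P (input w) s) (2, i)" by blast
      then show "g w i" using halts_at_unique[OF t(1)] out by blast
    qed
  qed
  show ?thesis
    by (rule baire_property_cong_meager[OF B]; rule meager_subset[OF d(2)]; use eq in blast)
qed

section \<open>Equality, well-orders and hereditarily countable sets\<close>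

text \<open>The fixed real parameter only contributes constant input bits.\<close>

lemma baire_property_computable:
  fixes code :: "'a::second_countable_topology \<Rightarrow> cantor"
  assumes f: "itt_computable_on X f" and X: "\<And>w. code w \<in> X"
    and code: "\<And>i. baire_property {w. code w i}"
  shows "baire_property {w. f (code w) i}"
proof -
  obtain P z where P: "\<And>x. x \<in> X \<Longrightarrow> halts_with P (join x z) (f x)"
    using f unfolding itt_computable_on_def by blast
  have "baire_property {w. join (code w) z i}" for i
    by (cases "even i") (simp_all add: join_def code baire_property_const del: Collect_const)
  then show ?thesis
    by (rule baire_property_output[where P = P and input = "\<lambda>w. join (code w) z"]) (intro P X)
qed

lemma ex_not_in_meager:
  fixes U :: "(nat \<Rightarrow> nat) set"
  assumes "meager A" "open U" "U \<noteq> {}" shows "\<exists>w\<in>U. w \<notin> A"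
  using not_meager_seq[OF assms(2,3)] meager_subset[OF assms(1), of U] by blast

lemma E0_refl: "E0 x x"
  by (simp add: E0_def)

theorem E0_not_reducible_to_equality: "\<not> itt_reducible E0 UNIV (=) UNIV"
proof
  assume "itt_reducible E0 UNIV (=) UNIV"
  then obtain f where f: "itt_computable_on UNIV f" "\<And>x y. E0 x y \<longleftrightarrow> f x = f y"
    unfolding itt_reducible_def by auto
  have bp: "baire_property {w. f (parity w) i}" for i
    by (rule baire_property_computable[OF f(1) UNIV_I baire_property_parity])
  have inv: "f (parity g) = f (parity h)" if "finite {i. g i \<noteq> h i}" for g h
  proof -
    have "E0 (parity g) (parity h)"
      unfolding E0_def by (rule finite_subset[OF _ that]) (auto simp: parity_def)
    then show ?thesis using f(2) by blast
  qed
  \<comment> \<open>By the zero-one law each output bit has one generic value; \<open>v\<close>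
    collects these values.\<close>
  define v where "v i \<longleftrightarrow> \<not> meager {w. f (parity w) i}" for i
  have "meager {w. f (parity w) i \<noteq> v i}" for i
  proof (cases "v i")
    case True
    have "meager (- {w. f (parity w) i})"
      by (rule zero_one_law[OF bp]) (use True inv in \<open>auto simp: v_def\<close>)
    then show ?thesis using True by (auto elim: meager_subset)
  next
    case False
    then show ?thesis by (simp add: v_def)
  qed
  then have M: "meager (\<Union>i. {w. f (parity w) i \<noteq> v i})" by (intro meager_UN) auto
  have eq: "f (parity w) = v" if "w \<notin> (\<Union>i. {w. f (parity w) i \<noteq> v i})" for w
    using that by auto
  obtain w where w: "w \<notin> (\<Union>i. {w. f (parity w) i \<noteq> v i})"
    using ex_not_in_meager[OF M open_UNIV] by blast
  have "meager (UNIV :: (nat \<Rightarrow> nat) set)"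
  proof (rule meager_subset[OF meager_Un[OF M meager_E0_class_parity[of "parity w"]]], rule subsetI, rule UnCI)
    fix w' assume "w' \<notin> {w'. E0 (parity w') (parity w)}"
    then have "f (parity w') \<noteq> f (parity w)" using f(2) by blast
    then have "f (parity w') \<noteq> v" using eq[OF w] by simp
    then show "w' \<in> (\<Union>i. {w. f (parity w) i \<noteq> v i})" using eq[of w'] by argo
  qed
  then show False using not_meager_seq[OF open_UNIV] by blast
qed

text \<open>The common core of both halves of (3). The coding may be any map whose bits have the
  Baire property, as long as the isomorphism type of the value determines
  \<open>parity w\<close>.\<close>

lemma no_computable_WO_assignment:
  fixes code :: "(nat \<Rightarrow> nat) \<Rightarrow> cantor"
  assumes f: "itt_computable_on X f" and X: "\<And>w. code w \<in> X"
    and code: "\<And>i. baire_property {w. code w i}"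
    and WO: "\<And>x. x \<in> X \<Longrightarrow> f x \<in> WO"
    and inj: "\<And>w w'. iso_WO (f (code w)) (f (code w')) \<Longrightarrow> parity w = parity w'"
  shows False
proof -
  define \<rho> where "\<rho> w = coded_rel (f (code w))" for w
  have wo: "Well_order (\<rho> w)" for w using WO[OF X] unfolding WO_def \<rho>_def by blast
  have "\<exists>\<phi> :: nat \<Rightarrow> stage. (\<forall>x\<in>Field (\<rho> w). \<forall>y\<in>Field (\<rho> w). (x, y) \<in> \<rho> w \<longleftrightarrow> \<phi> x \<le> \<phi> y) \<and>
      (\<forall>x\<in>Field (\<rho> w). \<forall>t<\<phi> x. \<exists>y\<in>Field (\<rho> w). \<phi> y = t)" for w
    by (rule embed_stage[OF wo[of w] card_nat_less_stage]) (intro exI conjI ballI allI impI; assumption?; blast)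
  then obtain \<phi> :: "(nat \<Rightarrow> nat) \<Rightarrow> nat \<Rightarrow> stage"
    where \<phi>: "\<And>w x y. x \<in> Field (\<rho> w) \<Longrightarrow> y \<in> Field (\<rho> w) \<Longrightarrow> (x, y) \<in> \<rho> w \<longleftrightarrow> \<phi> w x \<le> \<phi> w y"
      "\<And>w x t. x \<in> Field (\<rho> w) \<Longrightarrow> t < \<phi> w x \<Longrightarrow> \<exists>y\<in>Field (\<rho> w). \<phi> w y = t"
    by metis
  have anti: "antisym (\<rho> w)" for w using wo[of w]
    unfolding well_order_on_def linear_order_on_def partial_order_on_def by blast
  have \<phi>_inj: "inj_on (\<phi> w) (Field (\<rho> w))" for w
  proof (rule inj_onI)
    fix x y assume "x \<in> Field (\<rho> w)" "y \<in> Field (\<rho> w)" "\<phi> w x = \<phi> w y"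
    then have "(x, y) \<in> \<rho> w" "(y, x) \<in> \<rho> w" using \<phi>(1)[of x w y] \<phi>(1)[of y w x] by auto
    then show "x = y" using anti by (meson antisymD)
  qed
  have lt: "lt_in (\<rho> w) m n \<longleftrightarrow> m \<in> Field (\<rho> w) \<and> n \<in> Field (\<rho> w) \<and> \<phi> w m < \<phi> w n" for w m n
  proof (cases "m \<in> Field (\<rho> w) \<and> n \<in> Field (\<rho> w)")
    case True
    then have "\<phi> w m = \<phi> w n \<longleftrightarrow> m = n" using \<phi>_inj by (metis inj_onD)
    then show ?thesis using True \<phi>(1)[of m w n] unfolding lt_in_def less_le by blast
  next
    case False
    then show ?thesis unfolding lt_in_def Field_def by blast
  qed
  \<comment> \<open>Rank at most \<open>t\<close>, vacuously so outside the field. The recursion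
    \<open>N_rec\<close> expresses it through smaller ranks of predecessors, which yields the Baire
    property by induction on \<open>t\<close>.\<close>
  define N where "N t n = {w. n \<in> Field (\<rho> w) \<longrightarrow> \<phi> w n \<le> t}" for t n
  have N_rec: "N t n = {w. \<forall>m\<in>UNIV. \<not> lt_in (\<rho> w) m n \<or> (\<exists>s\<in>{..<t}. w \<in> N s m)}" for t n
  proof safe
    fix w m assume "w \<in> N t n" and no: "\<not> (\<exists>s\<in>{..<t}. w \<in> N s m)" and l: "lt_in (\<rho> w) m n"
    then have "\<phi> w m < t" unfolding lt N_def by auto
    moreover have "w \<in> N (\<phi> w m) m" unfolding N_def by simp
    ultimately show False using no by blast
  next
    fix w assume R: "\<forall>m\<in>UNIV. \<not> lt_in (\<rho> w) m n \<or> (\<exists>s\<in>{..<t}. w \<in> N s m)"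
    show "w \<in> N t n"
    proof (rule ccontr)
      assume "w \<notin> N t n"
      then have n: "n \<in> Field (\<rho> w)" "t < \<phi> w n" unfolding N_def by (auto simp: not_le)
      then obtain m where m: "m \<in> Field (\<rho> w)" "\<phi> w m = t" using \<phi>(2) by blast
      then have "lt_in (\<rho> w) m n" using n lt by simp
      then obtain s where "s < t" "w \<in> N s m" using R by auto
      then show False using m unfolding N_def by auto
    qed
  qed
  have bp_rel: "baire_property {w. (m, n) \<in> \<rho> w}" for m n
    unfolding \<rho>_def coded_rel_def using baire_property_computable[OF f X code] by simp
  have bp: "baire_property (N t n)" if "t < omega1" for t n
    using that
  proof (induction t arbitrary: n rule: less_induct)
    case (less t)
    have "baire_property {w. w \<in> N s m}" if "s \<in> {..<t}" for s m
      using less.IH[of s m] that less.prems by (simp add: less_trans)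
    then show ?case
      unfolding N_rec[of t n] lt_in_def using countable_lessThan_stage[OF less.prems]
      by (intro baire_property_Ball baire_property_disj baire_property_not baire_property_conj
          baire_property_Bex bp_rel baire_property_const) auto
  qed
  have N_mono: "N s n \<subseteq> N t n" if "s \<le> t" for s t n
    unfolding N_def using that by (auto intro: order_trans)
  \<comment> \<open>The sets \<open>N t n\<close> grow with \<open>t\<close>, hence so do the
    countable sets forcing them, and these become constant.\<close>
  obtain t0 where t0: "t0 < omega1" "\<And>t n. t < omega1 \<Longrightarrow> forced (N t n) \<subseteq> forced (N t0 n)"
  proof -
    define D where "D = {p \<in> basic \<times> (UNIV :: nat set). \<exists>t < omega1. fst p \<in> forced (N t (snd p))}"
    have "\<forall>p\<in>D. \<exists>t. t < omega1 \<and> fst p \<in> forced (N t (snd p))" unfolding D_def by blast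
    from bchoice[OF this] obtain \<tau> where \<tau>: "\<forall>p\<in>D. \<tau> p < omega1 \<and> fst p \<in> forced (N (\<tau> p) (snd p))" ..
    have "countable (\<tau> ` D)"
      by (intro countable_image countable_subset[of D "basic \<times> UNIV"]) (auto simp: countable_basic D_def)
    then obtain t0 where t0: "t0 < omega1" "\<forall>s\<in>\<tau> ` D. s < t0"
      using countable_bounded_omega1[of "\<tau> ` D"] \<tau> by blast
    have "forced (N t n) \<subseteq> forced (N t0 n)" if t: "t < omega1" for t n
    proof
      fix b assume b: "b \<in> forced (N t n)"
      then have p: "(b, n) \<in> D" using t unfolding D_def forced_def by auto
      then have "meager (b - N (\<tau> (b, n)) n)" "\<tau> (b, n) \<le> t0" using \<tau> t0(2) unfolding forced_def by auto
      then have "meager (b - N t0 n)" using N_mono[of "\<tau> (b, n)" t0 n] by (auto elim!: meager_subset)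
      then show "b \<in> forced (N t0 n)" using b unfolding forced_def by blast
    qed
    then show thesis using that t0(1) by blast
  qed
  \<comment> \<open>A single stage beyond \<open>t0\<close> suffices: if all predecessors have rank
    at most \<open>t0\<close>, the element has rank at most \<open>t\<close>, and generically this
    already means at most \<open>t0\<close>.\<close>
  obtain t where t: "t < omega1" "t0 < t" using countable_bounded_omega1[of "{t0}"] t0(1) by auto
  have "meager (N t n - N t0 n)" for n
  proof -
    have "meager (\<Union>b\<in>forced (N t n). b - N t0 n)"
      using t0(2)[OF t(1), of n] by (intro meager_UN countable_forced) (auto simp: forced_def)
    then show ?thesis
      by (rule meager_subset[OF meager_Un[OF meager_diff_forced[OF bp[OF t(1)]]]]) blast
  qed
  then have M: "meager (\<Union>n. N t n - N t0 n)" by (intro meager_UN) auto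
  have bounded: "\<phi> w n \<le> t0" if w: "w \<notin> (\<Union>n. N t n - N t0 n)" and n: "n \<in> Field (\<rho> w)" for w n
    using n
  proof (induction "\<phi> w n" arbitrary: n rule: less_induct)
    case less
    have "w \<in> N t n"
      unfolding N_rec[of t n]
    proof safe
      fix m assume no: "\<not> (\<exists>s\<in>{..<t}. w \<in> N s m)" and "lt_in (\<rho> w) m n"
      then have "\<phi> w m \<le> t0" using less.hyps lt by blast
      then have "w \<in> N t0 m" unfolding N_def by blast
      then show False using no t(2) by blast
    qed
    then have "w \<in> N t0 n" using w by blast
    then show ?case using less.prems unfolding N_def by blast
  qed
  \<comment> \<open>The initial segment \<open>I w\<close> represents the order type of
    \<open>\<rho> w\<close>. For generic \<open>w\<close> it lies in \<open>J\<close>, the countable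
    set of initial segments of \<open>{..t0}\<close>.\<close>
  define I where "I w = \<phi> w ` Field (\<rho> w)" for w
  define J where "J = insert {..t0} ((\<lambda>s. {..<s}) ` {..t0})"
  have cJ: "countable J"
  proof -
    have "{..t0} = insert t0 {..<t0}" by auto
    then show ?thesis unfolding J_def using countable_lessThan_stage[OF t0(1)] by simp
  qed
  have I_J: "I w \<in> J" if w: "w \<notin> (\<Union>n. N t n - N t0 n)" for w
  proof (cases "I w = {..t0}")
    case True then show ?thesis unfolding J_def by blast
  next
    case False
    have sub: "I w \<subseteq> {..t0}" using bounded[OF w] unfolding I_def by auto
    define s where "s = (LEAST s. s \<notin> I w)"
    obtain s' where s': "s' \<le> t0" "s' \<notin> I w" using False sub by auto
    have s: "s \<notin> I w" unfolding s_def using s'(2) by (rule LeastI)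
    have "s \<le> t0" using Least_le[of "\<lambda>s. s \<notin> I w", OF s'(2)] s'(1) unfolding s_def by simp
    moreover have "I w = {..<s}"
    proof safe
      fix u assume u: "u \<in> I w"
      show "u < s"
      proof (rule ccontr)
        assume "\<not> u < s"
        then have "s < u" using u s by (metis linorder_neqE)
        then show False using u s \<phi>(2) unfolding I_def by blast
      qed
    next
      fix u assume "u < s" then show "u \<in> I w" unfolding s_def using not_less_Least by blast
    qed
    ultimately show ?thesis unfolding J_def by blast
  qed
  have iso: "iso_WO (f (code w)) (f (code w'))" if eq: "I w = I w'" for w w'
  proof -
    let ?g = "\<lambda>n. inv_into (Field (\<rho> w')) (\<phi> w') (\<phi> w n)"
    have b: "bij_betw (\<phi> w) (Field (\<rho> w)) (I w)" for w
      using \<phi>_inj unfolding I_def bij_betw_def by blast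
    have g: "bij_betw ?g (Field (\<rho> w)) (Field (\<rho> w'))"
      using bij_betw_trans[OF b[of w] bij_betw_inv_into[OF b[of w'], folded eq]] by (simp add: o_def)
    have \<phi>g: "\<phi> w' (?g n) = \<phi> w n" if "n \<in> Field (\<rho> w)" for n
      using that eq by (intro f_inv_into_f) (auto simp: I_def)
    have "iso (\<rho> w) (\<rho> w') ?g"
      unfolding iso_iff2
    proof (intro conjI ballI g)
      fix x y assume x: "x \<in> Field (\<rho> w)" and y: "y \<in> Field (\<rho> w)"
      have "?g x \<in> Field (\<rho> w')" "?g y \<in> Field (\<rho> w')" using g x y by (auto simp: bij_betw_def)
      then show "(x, y) \<in> \<rho> w \<longleftrightarrow> (?g x, ?g y) \<in> \<rho> w'" using \<phi>(1) \<phi>g x y by simp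
    qed
    then show ?thesis unfolding iso_WO_def ordIso_def using wo unfolding \<rho>_def by blast
  qed
  \<comment> \<open>Equal segments give isomorphic well-orders, so \<open>parity\<close> is constant
    on the fibre, which therefore lies in one \<open>E0\<close>-class.\<close>
  have "meager {w. I w = S}" for S
  proof (cases "\<exists>w0. I w0 = S")
    case True
    then obtain w0 where "I w0 = S" by blast
    then have "parity w = parity w0" if "I w = S" for w using inj iso that by metis
    then show ?thesis by (intro meager_subset[OF meager_E0_class_parity[of "parity w0"]]) (auto simp: E0_refl)
  next
    case False
    then have "{w. I w = S} = {}" by blast
    then show ?thesis by simp
  qed
  then have "meager (\<Union>S\<in>J. {w. I w = S})" by (intro meager_UN cJ)
  then have "meager (UNIV :: (nat \<Rightarrow> nat) set)"
    by (rule meager_subset[OF meager_Un[OF M]]) (use I_J in blast)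
  then show False using not_meager_seq[OF open_UNIV] by blast
qed

theorem Eset_not_reducible_to_iso_WO: "\<not> itt_reducible Eset UNIV iso_WO WO"
proof
  assume "itt_reducible Eset UNIV iso_WO WO"
  then obtain f where f: "\<And>x. f x \<in> WO" "itt_computable_on UNIV f" "\<And>x y. Eset x y \<longleftrightarrow> iso_WO (f x) (f y)"
    unfolding itt_reducible_def by auto
  \<comment> \<open>The sequence constantly equal to \<open>parity w\<close>, which turns
    \<open>Eset\<close> into equality of reals.\<close>
  define code where "code w m = parity w (snd (prod_decode m))" for w m
  have "range (seq_entry (code w)) = {parity w}" for w
    by (auto simp: seq_entry_def code_def)
  then have inj: "parity w = parity w'" if "Eset (code w) (code w')" for w w'
    using that unfolding Eset_def by auto
  have bp: "baire_property {w. code w m}" for m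
    unfolding code_def by (rule baire_property_parity)
  show False
    by (rule no_computable_WO_assignment[where code = code, OF f(2) UNIV_I bp f(1) inj]) (simp_all add: f(3))
qed

text \<open>The hereditarily countable set \<open>\<omega> \<union> {a}\<close> with \<open>a = {1} \<union> {n + 2 | x n}\<close>: the code \<open>0\<close> stands
  for \<open>a\<close> and the code \<open>n + 1\<close> for the ordinal \<open>n\<close>.  As \<open>a\<close> is nonempty and omits \<open>0\<close>, it is never an
  ordinal.\<close>

definition omega_with_set :: "cantor \<Rightarrow> nat \<Rightarrow> nat \<Rightarrow> bool" where
  "omega_with_set x i j \<longleftrightarrow> (if j = 0 then i = 2 \<or> (3 \<le> i \<and> x (i - 3)) else i \<noteq> 0 \<and> i < j)"

text \<open>Positive codes are determined by their predecessors. The predecessors of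
  \<open>0\<close> include \<open>2\<close> but not \<open>1\<close>, whereas a positive code above
  \<open>2\<close> is also above \<open>1\<close>.\<close>

lemma omega_with_set_extensional:
  assumes "\<And>k. omega_with_set x k n \<longleftrightarrow> omega_with_set x k m"
  shows "n = m"
proof -
  have pos: "omega_with_set x k j \<longleftrightarrow> k \<noteq> 0 \<and> k < j" if "j \<noteq> 0" for k j
    using that by (simp add: omega_with_set_def)
  have zero: False if "j \<noteq> 0" "\<And>k. omega_with_set x k 0 \<longleftrightarrow> omega_with_set x k j" for j
  proof -
    have "omega_with_set x 2 j" using that(2)[of 2] by (simp add: omega_with_set_def)
    then have "omega_with_set x 1 j" using pos[OF that(1)] by simp
    then show False using that(2)[of 1] by (simp add: omega_with_set_def)
  qed
  show ?thesis
  proof (cases "n = 0 \<or> m = 0")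
    case True then show ?thesis using zero assms by metis
  next
    case False
    then show ?thesis using assms[of n] assms[of m] pos[of n] pos[of m] by auto
  qed
qed

text \<open>The isomorphism fixes each positive code by induction: \<open>F j\<close> and
  \<open>j\<close> have the same predecessors, so extensionality applies. Then it fixes
  \<open>0\<close> too, and the predecessors of \<open>0\<close> reveal the real.\<close>

lemma omega_with_set_iso:
  assumes F: "bij F" and iso: "\<And>n m. omega_with_set x n m \<longleftrightarrow> omega_with_set y (F n) (F m)"
  shows "x = y"
proof -
  have inj: "F n = F m \<longleftrightarrow> n = m" for n m using F by (meson bij_def inj_eq)
  have fixed: "F j = j" if "j \<noteq> 0" for j
    using that
  proof (induction j rule: less_induct)
    case (less j)
    show ?case
    proof (rule omega_with_set_extensional[of y])
      fix k
      obtain k' where k': "k = F k'" using F by (meson bij_pointE)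
      have "omega_with_set y k (F j) \<longleftrightarrow> k' \<noteq> 0 \<and> k' < j"
        using iso[of k' j] k' less.prems by (simp add: omega_with_set_def)
      also have "\<dots> \<longleftrightarrow> k \<noteq> 0 \<and> k < j"
        using less.IH[of k'] less.IH[of k] inj[of k k'] k' by auto
      also have "\<dots> \<longleftrightarrow> omega_with_set y k j" using less.prems by (simp add: omega_with_set_def)
      finally show "omega_with_set y k (F j) \<longleftrightarrow> omega_with_set y k j" .
    qed
  qed
  have F0: "F 0 = 0" using fixed[of "F 0"] inj[of "F 0" 0] by auto
  show ?thesis
  proof
    fix i show "x i = y i"
      using iso[of "i + 3" 0] fixed[of "i + 3"] F0 by (simp add: omega_with_set_def)
  qed
qed

theorem iso_HC_not_reducible_to_iso_WO: "\<not> itt_reducible iso_HC HC iso_WO WO"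
proof
  assume "itt_reducible iso_HC HC iso_WO WO"
  then obtain f where f: "\<And>x. x \<in> HC \<Longrightarrow> f x \<in> WO" "itt_computable_on HC f"
    "\<And>x y. x \<in> HC \<Longrightarrow> y \<in> HC \<Longrightarrow> iso_HC x y \<longleftrightarrow> iso_WO (f x) (f y)"
    unfolding itt_reducible_def by auto
  define code where "code w m = (case prod_decode m of (i, j) \<Rightarrow> omega_with_set (parity w) i j)" for w m
  have rel: "(n, m) \<in> coded_rel (code w) \<longleftrightarrow> omega_with_set (parity w) n m" for w n m
    by (simp add: coded_rel_def code_def)
  have HC: "code w \<in> HC" for w
  proof -
    \<comment> \<open>The code \<open>0\<close> is ranked above all positive codes, which keep their
      usual order.\<close>
    have "wf (inv_image (less_than <*lex*> less_than) (\<lambda>k::nat. if k = 0 then (1::nat, 0::nat) else (0, k)))"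
      by (intro wf_inv_image wf_lex_prod wf_less_than)
    then have "wf (coded_rel (code w))"
      by (rule wf_subset) (auto simp: rel omega_with_set_def split: if_splits)
    then show ?thesis unfolding HC_def using omega_with_set_extensional by (auto simp: rel)
  qed
  have bp: "baire_property {w. code w m}" for m
  proof -
    obtain i j where ij: "prod_decode m = (i, j)" by (cases "prod_decode m")
    show ?thesis
      unfolding code_def ij prod.case omega_with_set_def
      by (cases "j = 0")
        (simp_all only: if_True if_False simp_thms, (intro baire_property_disj baire_property_conj
            baire_property_const baire_property_parity)+)
  qed
  have inj: "parity w = parity w'" if "iso_WO (f (code w)) (f (code w'))" for w w'
  proof -
    have "iso_HC (code w) (code w')" using f(3) HC that by blast
    then show ?thesis unfolding iso_HC_def rel using omega_with_set_iso by blast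
  qed
  show False
    by (rule no_computable_WO_assignment[where code = code, OF f(2) HC bp f(1) inj])
qed

section \<open>Countable sets of reals\<close>

text \<open>For \<open>a = (a 0, a 1, \<dots>)\<close> the reals \<open>e0_entry a c\<close> enumerate the union over \<open>i\<close> of the \<open>E0\<close>-class of
  \<open>a i\<close> tagged with \<open>i\<close>, where \<open>c\<close> codes \<open>i\<close> together with a finite modification.\<close>

definition e0_entry :: "(nat \<Rightarrow> nat \<Rightarrow> nat) \<Rightarrow> nat \<Rightarrow> cantor" where
  "e0_entry a c = (case prod_decode c of (i, D) \<Rightarrow>
     join (\<lambda>j. j = i) (\<lambda>j. parity (a i) j \<noteq> (j \<in> set_decode D)))"

text \<open>The map \<open>h\<close> only reorders and repeats entries: for surjective
  \<open>h\<close> the coded set depends on \<open>a\<close> alone.\<close>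

definition e0_code :: "(nat \<Rightarrow> nat \<Rightarrow> nat) \<Rightarrow> (nat \<Rightarrow> nat) \<Rightarrow> cantor" where
  "e0_code a h m = (case prod_decode m of (n, j) \<Rightarrow> e0_entry a (h n) j)"

lemma seq_entry_e0_code: "seq_entry (e0_code a h) n = e0_entry a (h n)"
  by (simp add: seq_entry_def e0_code_def)

lemma range_e0_code: "surj h \<Longrightarrow> range (seq_entry (e0_code a h)) = range (e0_entry a)"
  unfolding seq_entry_e0_code by (metis image_image)

lemma join_eq_iff: "join x z = join x' z' \<longleftrightarrow> x = x' \<and> z = z'"
proof safe
  assume "join x z = join x' z'"
  then have *: "join x z n = join x' z' n" for n by simp
  show "x = x'" using *[of "2 * n" for n] by (auto simp: join_def)
  show "z = z'" using *[of "2 * n + 1" for n] by (auto simp: join_def)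
qed

text \<open>The unmodified entry with tag \<open>k\<close> must occur on the other side; the tag
  forces the same index there, and the modification is finite.\<close>

lemma Eset_e0_code_imp_E0:
  assumes "Eset (e0_code a h) (e0_code a' h')" "surj h" "surj h'"
  shows "E0 (parity (a k)) (parity (a' k))"
proof -
  have "range (e0_entry a) = range (e0_entry a')"
    using assms by (simp add: Eset_def range_e0_code)
  then obtain c where c: "e0_entry a (prod_encode (k, 0)) = e0_entry a' c" by (metis rangeE rangeI)
  obtain i D where iD: "prod_decode c = (i, D)" by (cases "prod_decode c")
  have eq: "(\<lambda>j. j = k) = (\<lambda>j. j = i)" "(\<lambda>j. parity (a k) j) = (\<lambda>j. parity (a' i) j \<noteq> (j \<in> set_decode D))"
    using c by (simp_all add: e0_entry_def iD join_eq_iff)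
  have "k = i" using fun_cong[OF eq(1), of i] by simp
  then have "{n. parity (a k) n \<noteq> parity (a' k) n} = set_decode D"
    using fun_cong[OF eq(2)] by auto
  then show ?thesis unfolding E0_def by simp
qed

lemma baire_property_e0_code:
  fixes A :: "'a::topological_space \<Rightarrow> nat \<Rightarrow> nat \<Rightarrow> nat"
  assumes A: "\<And>i j. continuous_on UNIV (\<lambda>z. A z i j)" and H: "\<And>n. continuous_on UNIV (\<lambda>z. H z n)"
  shows "baire_property {z. e0_code (A z) (H z) m}"
proof -
  obtain n j where nj: "prod_decode m = (n, j)" by (cases "prod_decode m")
  have entry: "baire_property {z. e0_entry (A z) c j}" for c
  proof -
    obtain i D where iD: "prod_decode c = (i, D)" by (cases "prod_decode c")
    have "baire_property {z. odd (A z i (j div 2)) \<noteq> (j div 2 \<in> set_decode D)}"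
      by (rule baire_property_discrete[OF A])
    then show ?thesis
      by (cases "even j") (simp_all add: e0_entry_def iD join_def parity_def baire_property_const del: Collect_const)
  qed
  have "baire_property {z. \<exists>c\<in>UNIV. H z n = c \<and> e0_entry (A z) c j}"
    by (intro baire_property_Bex baire_property_conj baire_property_discrete[OF H] entry) auto
  then show ?thesis by (simp add: e0_code_def nj)
qed

text \<open>Omitting a fixed value is a closed condition, and every cylinder can be left by taking
  that value at the next coordinate.\<close>

lemma meager_not_surj: "meager {h :: nat \<Rightarrow> nat. \<not> surj h}"
proof -
  have "meager {h :: nat \<Rightarrow> nat. c \<notin> range h}" for c
  proof (rule meager_closed)
    have "closed ((\<lambda>h::nat\<Rightarrow>nat. h n) -` (- {c}))" for n
      by (intro closed_vimage) (simp_all add: closed_def open_discrete)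
    then have "closed (\<Inter>n. (\<lambda>h::nat\<Rightarrow>nat. h n) -` (- {c}))" by blast
    moreover have "(\<Inter>n. (\<lambda>h::nat\<Rightarrow>nat. h n) -` (- {c})) = {h. c \<notin> range h}" by auto
    ultimately show "closed {h :: nat \<Rightarrow> nat. c \<notin> range h}" by simp
    show "interior {h :: nat \<Rightarrow> nat. c \<notin> range h} = {}"
    proof (rule ccontr)
      assume "interior {h :: nat \<Rightarrow> nat. c \<notin> range h} \<noteq> {}"
      then obtain h where h: "h \<in> interior {h :: nat \<Rightarrow> nat. c \<notin> range h}" by blast
      obtain n where n: "cylinder n h \<subseteq> {h. c \<notin> range h}"
        using cylinder_subset_open[OF open_interior h] interior_subset[of "{h :: nat \<Rightarrow> nat. c \<notin> range h}"] by blast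
      have "h(n := c) \<in> cylinder n h" by (simp add: cylinder_def)
      then have "c \<notin> range (h(n := c))" using n by blast
      then show False by (metis fun_upd_same rangeI)
    qed
  qed
  then have "meager (\<Union>c. {h :: nat \<Rightarrow> nat. c \<notin> range h})" by (intro meager_UN) auto
  then show ?thesis by (rule meager_subset) auto
qed

section \<open>Changing one coordinate of a sequence\<close>

lemma continuous_on_fun_upd:
  "continuous_on UNIV (\<lambda>(a :: nat \<Rightarrow> 'a::topological_space, u). a(k := u))"
proof (rule continuous_on_coordinatewise_then_product)
  fix i
  have "continuous_on UNIV (\<lambda>p::(nat \<Rightarrow> 'a) \<times> 'a. fst p i)"
    by (rule continuous_on_product_then_coordinatewise) (rule continuous_on_fst[OF continuous_on_id])
  then show "continuous_on UNIV (\<lambda>p. (case p of (a::nat \<Rightarrow> 'a, u) \<Rightarrow> a(k := u)) i)"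
    by (cases "i = k") (simp_all add: case_prod_beta continuous_on_snd[OF continuous_on_id])
qed

text \<open>Substitution at \<open>k\<close> is open because the overwritten value \<open>z\<close>
  can be restored continuously. With \<open>kuratowski_ulam\<close> this makes the coordinate
  \<open>k\<close> an independent generic variable.\<close>

lemma meager_vimage_fun_upd:
  fixes M :: "(nat \<Rightarrow> 'a::topological_space) set"
  assumes "meager M" shows "meager ((\<lambda>(a, u). a(k := u)) -` M)"
proof (rule meager_vimage[OF assms continuous_on_fun_upd])
  fix W :: "((nat \<Rightarrow> 'a) \<times> 'a) set" assume W: "open W"
  have cont: "continuous_on UNIV (\<lambda>a::nat \<Rightarrow> 'a. (a(k := z), a k))" for z
  proof (intro continuous_on_Pair continuous_on_coordinatewise_then_product)
    show "continuous_on UNIV (\<lambda>a::nat \<Rightarrow> 'a. (a(k := z)) i)" for i by (cases "i = k") simp_all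
  qed simp
  have "(\<lambda>(a, u). a(k := u)) ` W = (\<Union>z. (\<lambda>a. (a(k := z), a k)) -` W)"
  proof safe
    fix a u assume "(a, u) \<in> W"
    then show "a(k := u) \<in> (\<Union>z. (\<lambda>a. (a(k := z), a k)) -` W)"
      by (auto intro!: exI[of _ "a k"])
  next
    fix a z assume "(a(k := z), a k) \<in> W"
    then show "a \<in> (\<lambda>(a, u). a(k := u)) ` W" by (rule rev_image_eqI) simp
  qed
  then show "open ((\<lambda>(a, u). a(k := u)) ` W)"
    using W cont by (simp only:) (intro open_UN ballI open_vimage)
qed

text \<open>A permutation of the entry indices that undoes a finite change of \<open>a k\<close> on
  \<open>S\<close>: modifications of that class are composed with \<open>S\<close>, all other
  indices stay fixed.\<close>

definition flip :: "nat \<Rightarrow> nat set \<Rightarrow> nat \<Rightarrow> nat" where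
  "flip k S c = (case prod_decode c of (i, D) \<Rightarrow>
     if i = k then prod_encode (i, set_encode (sym_diff (set_decode D) S)) else c)"

lemma flip_flip: "finite S \<Longrightarrow> flip k S (flip k S c) = c"
proof -
  assume S: "finite S"
  obtain i D where iD: "prod_decode c = (i, D)" by (cases "prod_decode c")
  have c: "c = prod_encode (i, D)" using iD by (metis prod_decode_inverse)
  have "sym_diff (sym_diff (set_decode D) S) S = set_decode D" by blast
  then show ?thesis using S by (simp add: flip_def c)
qed

lemma e0_entry_flip:
  assumes "finite {j. u j \<noteq> u' j}"
  shows "e0_entry (a(k := u')) c = e0_entry (a(k := u)) (flip k {j. parity u j \<noteq> parity u' j} c)"
proof -
  have "finite {j. parity u j \<noteq> parity u' j}"
    by (rule finite_subset[OF _ assms]) (auto simp: parity_def)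
  then show ?thesis
    unfolding e0_entry_def flip_def
    by (auto simp: join_def fun_eq_iff split: prod.split)
qed

theorem Eset_not_reducible_to_E0: "\<not> itt_reducible Eset UNIV E0 UNIV"
proof
  assume "itt_reducible Eset UNIV E0 UNIV"
  then obtain f where f: "itt_computable_on UNIV f" "\<And>x y. Eset x y \<longleftrightarrow> E0 (f x) (f y)"
    unfolding itt_reducible_def by auto
  define G where "G a h = f (e0_code a h)" for a h
  have G_bp: "baire_property {z. G (A z) (H z) m}"
    if "\<And>i j. continuous_on UNIV (\<lambda>z. A z i j)" "\<And>n. continuous_on UNIV (\<lambda>z. H z n)"
    for A :: "'z::second_countable_topology \<Rightarrow> nat \<Rightarrow> nat \<Rightarrow> nat" and H m
    unfolding G_def by (intro baire_property_computable[OF f(1)] baire_property_e0_code that UNIV_I)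
  have coord: "continuous_on UNIV (\<lambda>a::nat \<Rightarrow> nat \<Rightarrow> nat. a i j)" for i j
    by (rule continuous_on_product_then_coordinatewise) simp
  \<comment> \<open>The \<open>a\<close> for which every output bit is generically constant along
    enumerations \<open>h\<close> in \<open>p\<close>.\<close>
  define S where "S p = {a. \<forall>m\<in>UNIV. meager {h\<in>p. \<not> G a h m} \<or> meager {h\<in>p. G a h m}}" for p
  have S_bp: "baire_property (S p)" if p: "open p" for p
  proof -
    have B: "baire_property {z. G (fst z) (snd z) m}" for m
    proof (rule G_bp)
      show "continuous_on UNIV (\<lambda>z::(nat \<Rightarrow> nat \<Rightarrow> nat) \<times> (nat \<Rightarrow> nat). fst z i j)" for i j
        by (rule continuous_on_compose2[OF coord continuous_on_fst[OF continuous_on_id]]) simp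
      show "continuous_on UNIV (\<lambda>z::(nat \<Rightarrow> nat \<Rightarrow> nat) \<times> (nat \<Rightarrow> nat). snd z n)" for n
        by (rule continuous_on_product_then_coordinatewise) (rule continuous_on_snd[OF continuous_on_id])
    qed
    note q = baire_property_category_quantifier[OF completely_metrizable_fun[OF completely_metrizable_nat] _ p]
    have "baire_property {a. meager {h\<in>p. \<not> G a h m}}" "baire_property {a. meager {h\<in>p. G a h m}}" for m
      using q[OF B[of m]] q[OF baire_property_not[OF B[of m]]] by simp_all
    then show ?thesis unfolding S_def
      by (intro baire_property_Ball baire_property_disj) auto
  qed
  have S_cover: "\<exists>p\<in>{p\<in>basic. p \<noteq> {}}. a \<in> S p" for a
  proof -
    \<comment> \<open>The output along the identity serves as reference. Each surjective
      \<open>h\<close> codes the same set, so its output differs from \<open>v\<close> finitely; the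
      countably many \<open>M D\<close> thus cover a comeager set, and one of them is comeager in
      some \<open>p\<close>.\<close>
    define v where "v = G a id"
    define M where "M D = {h. \<forall>m\<in>UNIV. G a h m \<longleftrightarrow> (v m \<noteq> (m \<in> set_decode D))}" for D
    have M_bp: "baire_property (M D)" for D
      unfolding M_def
      by (intro baire_property_Ball baire_property_iff baire_property_const G_bp continuous_on_const) auto
    have "h \<in> (\<Union>D. M D)" if h: "surj h" for h
    proof -
      have "Eset (e0_code a h) (e0_code a id)" using h by (simp add: Eset_def range_e0_code)
      then have fin: "finite {m. G a h m \<noteq> v m}" using f(2) by (simp add: G_def v_def E0_def)
      have "h \<in> M (set_encode {m. G a h m \<noteq> v m})" unfolding M_def using fin by auto
      then show ?thesis by blast
    qed
    then have "UNIV \<subseteq> {h. \<not> surj h} \<union> (\<Union>D. M D)" by blast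
    then have "\<not> (\<forall>D. meager (M D))"
      using meager_subset[OF meager_Un[OF meager_not_surj meager_UN[of UNIV M]], of UNIV]
        not_meager_seq[OF open_UNIV] by auto
    then obtain D where "\<not> meager (M D)" by blast
    then obtain p where p: "p \<in> basic" "p \<noteq> {}" "meager (p - M D)" using nonmeager_forced[OF M_bp] by blast
    have "meager {h\<in>p. \<not> G a h m} \<or> meager {h\<in>p. G a h m}" for m
    proof (cases "v m \<noteq> (m \<in> set_decode D)")
      case True
      then have "{h\<in>p. \<not> G a h m} \<subseteq> p - M D" unfolding M_def by auto
      then show ?thesis using meager_subset[OF p(3)] by blast
    next
      case False
      then have "{h\<in>p. G a h m} \<subseteq> p - M D" unfolding M_def by auto
      then show ?thesis using meager_subset[OF p(3)] by blast
    qed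
    then show ?thesis using p(1,2) unfolding S_def by blast
  qed
  have "\<exists>p\<in>{p\<in>basic. p \<noteq> {}}. \<not> meager (S p)"
  proof (rule ccontr)
    assume "\<not> ?thesis"
    then have "meager (\<Union>p\<in>{p\<in>basic. p \<noteq> {}}. S p)"
      by (intro meager_UN) (auto intro: countable_subset[OF _ countable_basic])
    then have "meager (UNIV :: (nat \<Rightarrow> nat \<Rightarrow> nat) set)" by (rule meager_subset) (use S_cover in blast)
    then show False using not_meager_seq2[OF open_UNIV] by blast
  qed
  then obtain p where p: "p \<in> basic" "p \<noteq> {}" "\<not> meager (S p)" by blast
  obtain s where s: "s \<in> basic" "s \<noteq> {}" "meager (s - S p)"
    using nonmeager_forced[OF S_bp[OF open_basic[OF p(1)]] p(3)] by blast
  obtain h0 where h0: "h0 \<in> p" using p(2) by blast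
  obtain n where n: "cylinder n h0 \<subseteq> p" using cylinder_subset_open[OF open_basic[OF p(1)] h0] by blast
  define c where "c = cylinder n h0"
  have c_ne: "c \<noteq> {}" unfolding c_def cylinder_def by blast
  have c_open: "open c" unfolding c_def by (rule open_cylinder)
  \<comment> \<open>The cylinder mentions only finitely many tags, so some tag \<open>k\<close> is
    left free.\<close>
  obtain k where "k \<notin> (\<lambda>i. fst (prod_decode (h0 i))) ` {..<n}"
    using ex_new_if_finite[OF infinite_UNIV_nat] by blast
  then have k: "\<And>i. i < n \<Longrightarrow> fst (prod_decode (h0 i)) \<noteq> k" by blast
  let ?upd = "\<lambda>(a, u). a(k := u) :: nat \<Rightarrow> nat \<Rightarrow> nat"
  obtain a0 where a0: "a0 \<in> s" using s(2) by blast
  have upd_open: "open (?upd -` s)"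
    by (rule open_vimage[OF open_basic[OF s(1)] continuous_on_fun_upd])
  have a0_upd: "(a0, a0 k) \<in> ?upd -` s" using a0 by simp
  obtain s1 s2 where s12: "open s1" "open s2" "a0 \<in> s1" "a0 k \<in> s2" "s1 \<times> s2 \<subseteq> ?upd -` s"
    by (rule open_prod_elim[OF upd_open a0_upd]) blast
  \<comment> \<open>All coordinates except \<open>k\<close> get frozen: for some \<open>a\<close>,
    generic \<open>u\<close> in \<open>s2\<close> satisfy
    \<open>a(k := u) \<in> S p\<close>.\<close>
  have "meager {a. \<not> meager {u. (a, u) \<in> ?upd -` (s - S p)}}"
    by (intro kuratowski_ulam meager_vimage_fun_upd s(3))
  moreover have "\<not> meager s1" using not_meager_seq2[OF s12(1)] s12(3) by blast
  ultimately obtain a where a: "a \<in> s1" "meager {u. (a, u) \<in> ?upd -` (s - S p)}"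
    using meager_subset[of "{a. \<not> meager {u. (a, u) \<in> ?upd -` (s - S p)}}" s1] by blast
  have mS: "meager {u\<in>s2. a(k := u) \<notin> S p}"
    by (rule meager_subset[OF a(2)]) (use a(1) s12(5) in auto)
  \<comment> \<open>The \<open>u\<close> for which output bit \<open>m\<close> is generically
    \<open>b\<close> on the cylinder \<open>c\<close>.\<close>
  define T where "T b m = {u. meager {h\<in>c. G (a(k := u)) h m \<noteq> b}}" for b m
  have T_bp: "baire_property (T b m)" for b m
  proof -
    have "baire_property {z. G (a(k := fst z)) (snd z) m}"
    proof (rule G_bp)
      show "continuous_on UNIV (\<lambda>z::(nat \<Rightarrow> nat) \<times> (nat \<Rightarrow> nat). (a(k := fst z)) i j)" for i j
        by (cases "i = k")
          (simp_all add: continuous_on_product_then_coordinatewise[OF continuous_on_fst[OF continuous_on_id]])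
      show "continuous_on UNIV (\<lambda>z::(nat \<Rightarrow> nat) \<times> (nat \<Rightarrow> nat). snd z n)" for n
        by (rule continuous_on_product_then_coordinatewise) (rule continuous_on_snd[OF continuous_on_id])
    qed
    then have "baire_property {z. G (a(k := fst z)) (snd z) m = b}"
      by (rule baire_property_iff[OF _ baire_property_const])
    from baire_property_category_quantifier[OF completely_metrizable_fun[OF completely_metrizable_nat] this c_open]
    show ?thesis unfolding T_def by simp
  qed
  \<comment> \<open>A finite change of \<open>u\<close> is absorbed by applying \<open>flip\<close>
    to the enumeration. This is a continuous involution, and it preserves \<open>c\<close> because
    \<open>c\<close> does not mention \<open>k\<close>.\<close>
  have T_inv: "u' \<in> T b m" if fin: "finite {i. u i \<noteq> u' i}" and u: "u \<in> T b m" for u u' b m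
  proof -
    let ?S = "{j. parity u j \<noteq> parity u' j}"
    have S: "finite ?S" by (rule finite_subset[OF _ fin]) (auto simp: parity_def)
    let ?\<pi> = "\<lambda>h i. flip k ?S (h i)"
    have code: "e0_code (a(k := u')) h = e0_code (a(k := u)) (?\<pi> h)" for h
      unfolding e0_code_def e0_entry_flip[OF fin] by simp
    have cyl: "?\<pi> h \<in> c \<longleftrightarrow> h \<in> c" for h
    proof -
      have "flip k ?S (h0 i) = h0 i" if "i < n" for i
        using k[OF that] by (auto simp: flip_def split: prod.split)
      then have "flip k ?S (h i) = h0 i \<longleftrightarrow> h i = h0 i" if "i < n" for i
        using that flip_flip[OF S, of k] by metis
      then show ?thesis by (simp add: c_def cylinder_def)
    qed
    have "meager (?\<pi> -` {h\<in>c. G (a(k := u)) h m \<noteq> b})"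
    proof (rule meager_vimage_involution)
      show "meager {h\<in>c. G (a(k := u)) h m \<noteq> b}" using u by (simp add: T_def)
      show "continuous_on UNIV ?\<pi>"
      proof (rule continuous_on_coordinatewise_then_product)
        show "continuous_on UNIV (\<lambda>h. flip k ?S (h i))" for i
          by (rule continuous_on_compose2[of UNIV "flip k ?S"]) simp_all
      qed
      show "?\<pi> (?\<pi> h) = h" for h by (rule ext) (rule flip_flip[OF S])
    qed
    moreover have "?\<pi> -` {h\<in>c. G (a(k := u)) h m \<noteq> b} = {h\<in>c. G (a(k := u')) h m \<noteq> b}"
      using cyl by (auto simp: G_def code)
    ultimately show ?thesis by (simp add: T_def)
  qed
  have "\<exists>b. meager (- T b m)" for m
  proof -
    have sub: "u \<in> T True m \<union> T False m" if "a(k := u) \<in> S p" for u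
    proof -
      have "meager {h\<in>p. \<not> G (a(k := u)) h m} \<or> meager {h\<in>p. G (a(k := u)) h m}"
        using that unfolding S_def by blast
      then have "meager {h\<in>c. \<not> G (a(k := u)) h m} \<or> meager {h\<in>c. G (a(k := u)) h m}"
        using n unfolding c_def by (elim disj_forward) (erule meager_subset, blast)+
      then show ?thesis by (simp add: T_def)
    qed
    have "\<not> meager s2" using not_meager_seq[OF s12(2)] s12(4) by blast
    moreover have "s2 \<subseteq> {u\<in>s2. a(k := u) \<notin> S p} \<union> (T True m \<union> T False m)" using sub by blast
    ultimately have "\<not> meager (T True m \<union> T False m)"
      using meager_subset[OF meager_Un[OF mS]] by blast
    then obtain b where b: "\<not> meager (T b m)" using meager_Un by blast
    have "meager (- T b m)"
      by (rule zero_one_law[OF T_bp _ b]) (rule T_inv)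
    then show ?thesis by blast
  qed
  then obtain v where v: "\<And>m. meager (- T (v m) m)" by metis
  define Q where "Q = (\<Union>m. - T (v m) m)"
  have Q: "meager Q" unfolding Q_def by (intro meager_UN v) simp
  \<comment> \<open>Generic \<open>u\<close> thus share the output \<open>v\<close>, although the
    coded set determines \<open>parity u\<close> up to \<open>E0\<close>; two inequivalent generic
    \<open>u\<close> contradict this.\<close>
  have value_v: "\<exists>h. surj h \<and> G (a(k := u)) h = v" if u: "u \<notin> Q" for u
  proof -
    have "meager (\<Union>m. {h\<in>c. G (a(k := u)) h m \<noteq> v m})"
      using u by (intro meager_UN) (auto simp: Q_def T_def)
    then obtain h where "h \<in> c" "h \<notin> (\<Union>m. {h\<in>c. G (a(k := u)) h m \<noteq> v m})" "surj h"
      using ex_not_in_meager[OF meager_Un[OF meager_not_surj] c_open c_ne] by blast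
    then show ?thesis by (intro exI[of _ h]) auto
  qed
  obtain u where u: "u \<notin> Q" using ex_not_in_meager[OF Q open_UNIV] by blast
  obtain u' where u': "u' \<notin> Q" "\<not> E0 (parity u') (parity u)"
    using ex_not_in_meager[OF meager_Un[OF Q meager_E0_class_parity[of "parity u"]] open_UNIV] by blast
  obtain h where h: "surj h" "G (a(k := u)) h = v" using value_v[OF u] by blast
  obtain h' where h': "surj h'" "G (a(k := u')) h' = v" using value_v[OF u'(1)] by blast
  have "Eset (e0_code (a(k := u')) h') (e0_code (a(k := u)) h)"
    using h(2) h'(2) f(2) E0_refl unfolding G_def by simp
  from Eset_e0_code_imp_E0[OF this h'(1) h(1), of k] show False using u'(2) by simp
qed

theorem mainTheorem8:
  shows "\<not> itt_reducible E0 UNIV (=) UNIV \<and>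
         \<not> itt_reducible Eset UNIV E0 UNIV \<and>
         \<not> itt_reducible iso_HC HC iso_WO WO \<and>
         \<not> itt_reducible Eset UNIV iso_WO WO"
  by (intro conjI E0_not_reducible_to_equality Eset_not_reducible_to_E0
      iso_HC_not_reducible_to_iso_WO Eset_not_reducible_to_iso_WO)

end
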